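(* Let $1\le p\le\infty$. Let $A$ and $B$ be non-empty, bounded, open sets in $\mathbb{R}^d$, with $r=\operatorname{diam}(A\cup B)$. Let $F:\mathbb{R}^d\to\mathbb{R}$ be in $L^p$ and supported on $A$, let $\Phi:B\to A$ be an $\epsilon$-deformation with inverse $\Psi=\Phi^{-1}$, and let $F_\Phi$ be the push-forward of $F$ by $\Phi^{-1}$, i.e. $F_\Phi(x)=F(\Phi(x))\,|\det(\nabla\Phi(x))|$ on $B$, and $0$ elsewhere. Then for any unit vector $u\in\mathbb{S}^{d-1}$, $$\|\mathcal{P}_uF-\mathcal{P}_uF_\Phi\|_{V^p}\le\epsilon^{1/p}\cdot\min\left\{C(\Psi,r)^{1-1/p}\cdot\|F\|_{L^p},\ \|F\|_{L^1}\right\},$$ where $$C(\Psi,r)=\max_{|t|\le r/2}\Big|\{x\in A:\ \langle x,u\rangle\le t\le\langle\Psi(x),u\rangle\ \text{ or }\ \langle\Psi(x),u\rangle\le t\le\langle x,u\rangle\}\Big|,$$ and $|E|$ denotes the Lebesgue measure of a set $E\subset\mathbb{R}^d$.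
   Context: For $p=\infty$, $1/p=0$; for $p=1$, $C(\Psi,r)^{1-1/p}=1$. For $\epsilon>0$, an $\epsilon$-deformation $\Phi:B\to A$ is a $C^1$ bijection of $B$ onto $A$ with $\det(\nabla\Phi(x))\ne0$ for all $x\in B$ and $|x-\Phi(x)|\le\epsilon$ (Euclidean norm) for all $x\in B$; $\nabla\Phi(x)$ is the Jacobian matrix. Tomographic projection onto the line spanned by a unit vector $u$: with $u_2,\dots,u_d$ an orthonormal basis of the orthogonal complement of $u$, $$(\mathcal{P}_uF)(t)=\int_{\mathbb{R}^{d-1}}F(tu+s_1u_2+\dots+s_{d-1}u_d)\,ds_1\cdots ds_{d-1}.$$ Volterra $p$-norm: for an integrable function $h$ of one variable supported in $[a,b]$, $(\mathcal{V}h)(x)=\int_a^xh(t)\,dt$ and $\|h\|_{V^p}=\|\mathcal{V}h\|_{L^p([a,b])}$, where $[a,b]$ is any bounded interval containing the supports of the functions involved (since $\mathcal{P}_uF-\mathcal{P}_uF_\Phi$ has integral $0$, the value does not depend on the choice).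
   Formalization: The maximum in C(Ψ,r) is taken over |t−c| ≤ r/2, where c is any number with |⟨x,u⟩−c| ≤ r/2 on A∪B (such c always exists), instead of |t| ≤ r/2; as printed the bound fails for sets far from the origin, e.g. d=1, A=B=(10,11), p>1, where C=0. *)

theory Defs
  imports "HOL-Analysis.Analysis" "HOL-Probability.Essential_Supremum"
begin

(* Exponents range over ennreal; 1 / infinity = 0 holds there. *)
definition inv_exponent :: "ennreal \<Rightarrow> real" where
  "inv_exponent p = enn2real (1 / p)"

(* c ^ (1 - 1/p), with value 1 at p = 1 even for c = 0 (in HOL, 0 powr 0 = 0). *)
definition conj_power :: "real \<Rightarrow> ennreal \<Rightarrow> real" where
  "conj_power c p = (if p = 1 then 1 else c powr (1 - inv_exponent p))"

definition Lp_norm :: "'a measure \<Rightarrow> ennreal \<Rightarrow> ('a \<Rightarrow> real) \<Rightarrow> ennreal" where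
  "Lp_norm M p f =
     (if p = \<infinity> then esssup M (\<lambda>x. ennreal \<bar>f x\<bar>)
      else (let I = (\<integral>\<^sup>+ x. ennreal (\<bar>f x\<bar> powr enn2real p) \<partial>M)
            in if I = \<infinity> then \<infinity> else ennreal (enn2real I powr inv_exponent p)))"

definition Lp_functions :: "'a measure \<Rightarrow> ennreal \<Rightarrow> ('a \<Rightarrow> real) set" where
  "Lp_functions M p = {f \<in> borel_measurable M. Lp_norm M p f < \<infinity>}"

definition deformation ::
  "real \<Rightarrow> (real^'n) set \<Rightarrow> (real^'n) set \<Rightarrow> (real^'n \<Rightarrow> real^'n) \<Rightarrow> bool" where
  "deformation \<epsilon> B A \<Phi> \<longleftrightarrow>
     bij_betw \<Phi> B A \<and>
     (\<forall>x\<in>B. \<Phi> differentiable (at x)) \<and>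
     continuous_on B (\<lambda>x. jacobian \<Phi> (at x)) \<and>
     (\<forall>x\<in>B. det (jacobian \<Phi> (at x)) \<noteq> 0) \<and>
     (\<forall>x\<in>B. norm (x - \<Phi> x) \<le> \<epsilon>)"

definition push_forward ::
  "(real^'n) set \<Rightarrow> (real^'n \<Rightarrow> real^'n) \<Rightarrow> (real^'n \<Rightarrow> real) \<Rightarrow> real^'n \<Rightarrow> real" where
  "push_forward B \<Phi> F x =
     (if x \<in> B then F (\<Phi> x) * \<bar>det (jacobian \<Phi> (at x))\<bar> else 0)"

definition orthonormal_complement_basis :: "real^'n \<Rightarrow> (real^'n) set \<Rightarrow> bool" where
  "orthonormal_complement_basis u U \<longleftrightarrow>
     pairwise orthogonal U \<and> (\<forall>v\<in>U. norm v = 1) \<and> span U = {x. x \<bullet> u = 0}"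

lemma orthonormal_complement_basis_exists:
  fixes u :: "real^'n"
  shows "\<exists>U. orthonormal_complement_basis u U"
proof -
  have "subspace {x. x \<bullet> u = 0}"
    by (simp add: subspace_def inner_add_left)
  then obtain U where "pairwise orthogonal U" "\<And>v. v \<in> U \<Longrightarrow> norm v = 1"
      "span U = {x. x \<bullet> u = 0}"
    using orthonormal_basis_subspace by metis
  then show ?thesis
    unfolding orthonormal_complement_basis_def by blast
qed

(* The coordinates s_1, ..., s_{d-1} are indexed by the basis vectors themselves, so the
   integration space is the product of one copy of the real line per element of U (a single
   point of mass 1 if d = 1). The completion makes it Lebesgue measure on R^(d-1), which is
   needed because F is only assumed to be Lebesgue measurable. *)
definition tomographic_projection ::
  "real^'n \<Rightarrow> (real^'n) set \<Rightarrow> (real^'n \<Rightarrow> real) \<Rightarrow> real \<Rightarrow> real" where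
  "tomographic_projection u U F t =
     (\<integral>s. F (t *\<^sub>R u + (\<Sum>v\<in>U. s v *\<^sub>R v)) \<partial>completion (\<Pi>\<^sub>M v\<in>U. lborel))"

definition volterra :: "real \<Rightarrow> (real \<Rightarrow> real) \<Rightarrow> real \<Rightarrow> real" where
  "volterra a h x = set_lebesgue_integral lebesgue {a..x} h"

definition volterra_norm :: "real \<Rightarrow> real \<Rightarrow> ennreal \<Rightarrow> (real \<Rightarrow> real) \<Rightarrow> ennreal" where
  "volterra_norm a b p h = Lp_norm (lebesgue_on {a..b}) p (volterra a h)"

definition crossing_set ::
  "(real^'n) set \<Rightarrow> (real^'n \<Rightarrow> real^'n) \<Rightarrow> real^'n \<Rightarrow> real \<Rightarrow> (real^'n) set" where
  "crossing_set A \<Psi> u t =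
     {x \<in> A. (x \<bullet> u \<le> t \<and> t \<le> \<Psi> x \<bullet> u) \<or> (\<Psi> x \<bullet> u \<le> t \<and> t \<le> x \<bullet> u)}"

(* The range |t| <= r/2 presupposes that the origin of the u-axis is at the centre of an
   interval of length r containing the projections of A and B. Here c is the coordinate of
   that centre; c = 0 is the normalised case. *)
definition crossing_const ::
  "(real^'n) set \<Rightarrow> (real^'n \<Rightarrow> real^'n) \<Rightarrow> real^'n \<Rightarrow> real \<Rightarrow> real \<Rightarrow> real" where
  "crossing_const A \<Psi> u c r =
     (SUP t\<in>{t. \<bar>t - c\<bar> \<le> r / 2}. measure lebesgue (crossing_set A \<Psi> u t))"

lemma centre_exists:
  fixes S :: "(real^'n) set"
  assumes "bounded S" "S \<noteq> {}" "norm u = 1"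
  shows "\<exists>c. \<forall>x\<in>S. \<bar>x \<bullet> u - c\<bar> \<le> diameter S / 2"
proof -
  let ?K = "(\<lambda>x. x \<bullet> u) ` S"
  have le: "x \<bullet> u \<le> y \<bullet> u + diameter S" if "x \<in> S" "y \<in> S" for x y
  proof -
    have "x \<bullet> u - y \<bullet> u \<le> norm (x - y)"
      using norm_cauchy_schwarz[of "x - y" u] assms(3) by (simp add: inner_diff_left)
    also have "\<dots> \<le> diameter S"
      using diameter_bounded_bound[OF assms(1) that] by (simp add: dist_norm)
    finally show ?thesis by simp
  qed
  obtain z where "z \<in> S" using assms(2) by blast
  then have bdd: "bdd_above ?K"
    using le by (intro bdd_aboveI[of _ "z \<bullet> u + diameter S"]) auto
  have "\<bar>x \<bullet> u - (Sup ?K - diameter S / 2)\<bar> \<le> diameter S / 2" if "x \<in> S" for x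
  proof -
    have "x \<bullet> u \<le> Sup ?K"
      using that bdd by (intro cSup_upper) auto
    moreover have "Sup ?K \<le> x \<bullet> u + diameter S"
      using le that assms(2) by (intro cSup_least) auto
    ultimately show ?thesis by linarith
  qed
  then show ?thesis by blast
qed

end

theory Submission
  imports Defs
begin

text \<open>
  Write \<open>P\<^sub>u\<close> for the tomographic projection along \<open>u\<close>. Integrating \<open>P\<^sub>u G\<close> over the ray
  \<open>{..x}\<close> is, by Fubini in an orthonormal frame containing \<open>u\<close>, the integral of \<open>G\<close> over the half
  space \<open>{y. y \<bullet> u \<le> x}\<close> (\<open>integral_tomographic_projection\<close>). For the push-forward, substituting
  \<open>y = \<Psi> z\<close> moves this integral back to \<open>F\<close> on the set \<open>{z. \<Psi> z \<bullet> u \<le> x}\<close>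
  (\<open>integral_push_forward\<close>). So the Volterra transform of the difference of the projections is
  \<open>x \<mapsto> \<integral> F y (1[y \<bullet> u \<le> x] - 1[\<Psi> y \<bullet> u \<le> x]) dy\<close>.

  The bracket vanishes unless \<open>x\<close> lies between \<open>y \<bullet> u\<close> and \<open>\<Psi> y \<bullet> u\<close>, that is, unless \<open>y\<close> is in
  the crossing set at level \<open>x\<close>. Two observations then give the estimate
  (\<open>Lp_norm_level_difference_le\<close>). For fixed \<open>x\<close>, the Hoelder inequality on the crossing set, whose
  measure is at most \<open>C(\<Psi>, r)\<close>, bounds the \<open>p\<close>-th power of the transform by \<open>C(\<Psi>, r)\<close> to the
  power \<open>p - 1\<close> times the integral of \<open>\<bar>F\<bar>\<close> to the \<open>p\<close> over the crossing set. For fixed \<open>y\<close>, the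
  levels \<open>x\<close> whose crossing set contains \<open>y\<close> form an interval of length
  \<open>\<bar>y \<bullet> u - \<Psi> y \<bullet> u\<bar> \<le> \<epsilon>\<close>, so Tonelli turns the integral over \<open>x\<close> into a factor \<open>\<epsilon>\<close>
  (\<open>nn_integral_straddle_le\<close>). The second term of the minimum comes from bounding all but one of
  the \<open>p\<close> factors by the \<open>L\<^sup>1\<close> norm of \<open>F\<close> instead.

  The supremum defining \<open>C(\<Psi>, r)\<close> is a maximum because the measure of the crossing set is an
  upper semicontinuous function of the level (\<open>straddle_measure_attains_max\<close>).
\<close>

section \<open>Change of variables over an arbitrary finite index type\<close>

text \<open>
  The change of variables formula on \<open>real^'m\<close> uses a well-order on the index type \<open>'m\<close>. To apply
  it over an arbitrary finite index type, coordinates are renamed along the bijection to a copy of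
  the type that is ordered by some injection into the natural numbers.
\<close>

typedef 'a ordered_copy = "UNIV :: 'a set" by simp

instantiation ordered_copy :: (finite) "{finite, wellorder}"
begin

definition rank_copy :: "'a ordered_copy \<Rightarrow> nat"
  where "rank_copy = (SOME f. inj f)"

definition less_eq_ordered_copy :: "'a ordered_copy \<Rightarrow> 'a ordered_copy \<Rightarrow> bool"
  where "x \<le> y \<longleftrightarrow> rank_copy x \<le> rank_copy y"

definition less_ordered_copy :: "'a ordered_copy \<Rightarrow> 'a ordered_copy \<Rightarrow> bool"
  where "x < y \<longleftrightarrow> rank_copy x < rank_copy y"

instance
proof -
  have fin: "finite (UNIV :: 'a ordered_copy set)"
    using type_definition.univ[OF type_definition_ordered_copy] finite_imageI[OF finite]
    by metis
  have "\<exists>f :: 'a ordered_copy \<Rightarrow> nat. inj f"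
    using finite_imp_inj_to_nat_seg[OF fin] by blast
  then have inj: "inj (rank_copy :: 'a ordered_copy \<Rightarrow> nat)"
    unfolding rank_copy_def by (rule someI_ex)
  show "OFCLASS('a ordered_copy, finite_class)"
    by standard (rule fin)
  show "OFCLASS('a ordered_copy, wellorder_class)"
  proof
    fix P :: "'a ordered_copy \<Rightarrow> bool" and a :: "'a ordered_copy"
    assume step: "\<And>x. (\<And>y. y < x \<Longrightarrow> P y) \<Longrightarrow> P x"
    show "P a"
      by (induction a rule: measure_induct_rule[of rank_copy])
         (use step in \<open>auto simp: less_ordered_copy_def\<close>)
  qed (use inj in \<open>auto simp: less_eq_ordered_copy_def less_ordered_copy_def inj_eq\<close>)
qed

end

lemma bij_Rep_ordered_copy: "bij Rep_ordered_copy"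
  by (metis bij_betw_def inj_on_def Rep_ordered_copy_inject type_definition.Rep_range[OF type_definition_ordered_copy])

definition reindex :: "('m \<Rightarrow> 'n) \<Rightarrow> real^'n \<Rightarrow> real^'m" where
  "reindex e x = (\<chi> i. x $ e i)"

lemma linear_reindex: "linear (reindex e)"
  by (rule linearI) (simp_all add: reindex_def vec_eq_iff)

lemma reindex_reindex_inv:
  assumes "bij e"
  shows "reindex e (reindex (inv e) x) = x" "reindex (inv e) (reindex e y) = y"
  using assms by (simp_all add: reindex_def vec_eq_iff bij_is_inj bij_is_surj surj_f_inv_f)

lemma bij_reindex: "bij e \<Longrightarrow> bij (reindex e)"
  by (metis bijI' reindex_reindex_inv)

text \<open>
  Renaming the indices conjugates each permutation in the Leibniz formula, and conjugation
  preserves the sign.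
\<close>

lemma det_reindex:
  fixes A :: "real^'n^'n" and e :: "'m::finite \<Rightarrow> 'n"
  assumes e: "bij e"
  shows "det (\<chi> i j. A $ e i $ e j) = det A"
proof -
  let ?c = "\<lambda>p. inv e \<circ> p \<circ> e"
  have perm: "p permutes UNIV \<longleftrightarrow> bij p" for p :: "'k \<Rightarrow> 'k"
    by (simp add: permutes_univ bij_iff)
  have inve: "bij (inv e)" "\<And>x. e (inv e x) = x" "\<And>y. inv e (e y) = y"
    using e by (simp_all add: bij_imp_bij_inv bij_is_inj bij_is_surj surj_f_inv_f)
  have sign: "sign (?c p) = sign p" if "bij p" for p
  proof -
    have "map_permutation UNIV (inv e) p = ?c p"
      using inve e by (auto simp: map_permutation_def fun_eq_iff bij_is_surj[of "inv e"] inv_inv_eq)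
    then show ?thesis
      using sign_map_permutation[of "inv e" UNIV p] that inve by (simp add: perm bij_is_inj)
  qed
  have "det A = (\<Sum>p | p permutes UNIV. of_int (sign p) * (\<Prod>i\<in>UNIV. A $ i $ p i))"
    by (simp add: det_def)
  also have "\<dots> = (\<Sum>q | q permutes UNIV. of_int (sign q) * (\<Prod>i\<in>UNIV. A $ e i $ e (q i)))"
  proof (rule sum.reindex_bij_witness[where i = "\<lambda>q. e \<circ> q \<circ> inv e" and j = ?c])
    fix p assume "p \<in> {p. p permutes (UNIV::'n set)}"
    then have p: "bij p" by (simp add: perm)
    have "(\<Prod>i\<in>UNIV. A $ i $ p i) = (\<Prod>i\<in>UNIV. A $ e i $ p (e i))"
      by (rule prod.reindex_bij_betw[OF e, symmetric])
    then show "of_int (sign (?c p)) * (\<Prod>i\<in>UNIV. A $ e i $ e (?c p i))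
      = of_int (sign p) * (\<Prod>i\<in>UNIV. A $ i $ p i)"
      using inve by (simp add: sign[OF p])
    show "?c p \<in> {p. p permutes UNIV}"
      using p e inve by (simp add: perm bij_comp)
  qed (use e inve in \<open>auto simp: fun_eq_iff perm bij_comp\<close>)
  finally show ?thesis by (simp add: det_def)
qed

lemma prod_Basis_vec: "(\<Prod>b\<in>Basis. f (x \<bullet> (b::real^'n))) = (\<Prod>i\<in>UNIV. f (x $ i))"
proof -
  have "bij_betw (\<lambda>i. axis i 1 :: real^'n) UNIV Basis"
    by (auto simp: bij_betw_def inj_on_def axis_eq_axis Basis_vec_def)
  from prod.reindex_bij_betw[OF this, of "\<lambda>b. f (x \<bullet> b)"]
  show ?thesis by (simp add: cart_eq_inner_axis)
qed

lemma distr_lborel_reindex: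
  fixes e :: "'m::finite \<Rightarrow> 'n::finite"
  assumes e: "bij e"
  shows "distr lborel borel (reindex e) = lborel"
proof (rule lborel_eqI[symmetric])
  fix l u :: "real^'m"
  assume lu: "\<And>b. b \<in> Basis \<Longrightarrow> l \<bullet> b \<le> u \<bullet> b"
  have [measurable]: "reindex e \<in> borel_measurable borel"
    using linear_reindex linear_conv_bounded_linear borel_measurable_continuous_onI
      linear_continuous_on by blast
  let ?l = "reindex (inv e) l" and ?u = "reindex (inv e) u"
  have inve: "\<And>x. e (inv e x) = x" "\<And>y. inv e (e y) = y" "bij (inv e)"
    using e by (simp_all add: bij_imp_bij_inv bij_is_inj bij_is_surj surj_f_inv_f)
  have box: "reindex e -` box l u = box ?l ?u"
    by (auto simp: mem_box_cart reindex_def) (metis inve)+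
  have lu': "l $ i \<le> u $ i" for i
    using lu[of "axis i 1"] by (simp add: cart_eq_inner_axis)
  have "emeasure (distr lborel borel (reindex e)) (box l u) = emeasure lborel (box ?l ?u)"
    by (subst emeasure_distr) (auto simp: box)
  also have "\<dots> = (\<Prod>b\<in>Basis. (?u - ?l) \<bullet> b)"
    by (rule emeasure_lborel_box)
       (use lu' in \<open>auto simp: Basis_vec_def reindex_def cart_eq_inner_axis[symmetric] inner_axis\<close>)
  also have "\<dots> = (\<Prod>b\<in>Basis. (u - l) \<bullet> b)"
    using prod.reindex_bij_betw[OF inve(3), of "\<lambda>i. u $ i - l $ i"]
    by (simp add: prod_Basis_vec[of "\<lambda>x. x", simplified] reindex_def)
  finally show "emeasure (distr lborel borel (reindex e)) (box l u) = (\<Prod>b\<in>Basis. (u - l) \<bullet> b)" .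
qed simp

text \<open>
  A Borel map that preserves Lebesgue-Borel measure preserves null sets, hence extends to the
  completion.
\<close>

lemma distr_lebesgue_eqI:
  assumes "distr lborel borel T = lborel" and "T \<in> borel_measurable borel"
  shows "T \<in> lebesgue \<rightarrow>\<^sub>M lebesgue" "distr lebesgue lebesgue T = lebesgue"
proof -
  have T: "T \<in> lebesgue \<rightarrow>\<^sub>M lborel"
    using assms(2) by (simp add: measurable_completion)
  have d: "distr lebesgue lborel T = lborel"
  proof -
    have "distr lebesgue lborel T = distr lborel lborel T"
      by (rule distr_completion) (use assms(2) in simp)
    also have "\<dots> = distr lborel borel T"
      by (rule distr_cong) simp_all
    finally show ?thesis using assms(1) by simp
  qed
  show "T \<in> lebesgue \<rightarrow>\<^sub>M lebesgue"
    by (rule completion.measurable_completion2[OF T]) (simp add: d)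
  show "distr lebesgue lebesgue T = lebesgue"
    using completion.completion_distr_eq[OF T] by (simp add: d)
qed

lemma lebesgue_reindex:
  fixes e :: "'m::finite \<Rightarrow> 'n::finite"
  assumes "bij e"
  shows "reindex e \<in> lebesgue \<rightarrow>\<^sub>M lebesgue" "distr lebesgue lebesgue (reindex e) = lebesgue"
proof -
  have "(reindex e :: real^'n \<Rightarrow> real^'m) \<in> borel_measurable borel"
    using linear_reindex linear_conv_bounded_linear borel_measurable_continuous_onI
      linear_continuous_on by blast
  from distr_lebesgue_eqI[OF distr_lborel_reindex[OF assms] this]
  show "reindex e \<in> lebesgue \<rightarrow>\<^sub>M lebesgue" "distr lebesgue lebesgue (reindex e) = lebesgue" .
qed

text \<open>
  Measurability passes through the bijection in both directions, and both integrals are 0 when it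
  fails.
\<close>

lemma integral_lebesgue_reindex:
  fixes e :: "'m::finite \<Rightarrow> 'n::finite" and f :: "real^'m \<Rightarrow> real"
  assumes e: "bij e"
  shows "integrable lebesgue (\<lambda>x. f (reindex e x)) \<longleftrightarrow> integrable lebesgue f"
    and "integral\<^sup>L lebesgue (\<lambda>x. f (reindex e x)) = integral\<^sup>L lebesgue f"
proof -
  note R = lebesgue_reindex[OF e]
  note R' = lebesgue_reindex[OF bij_imp_bij_inv[OF e]]
  have meas: "f \<in> borel_measurable lebesgue \<longleftrightarrow> (\<lambda>x. f (reindex e x)) \<in> borel_measurable lebesgue" (is "?f \<longleftrightarrow> ?fR")
  proof
    assume ?f then show ?fR by (rule measurable_compose[OF R(1)])
  next
    assume ?fR
    from measurable_compose[OF R'(1) this] show ?f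
      using reindex_reindex_inv[OF e] by simp
  qed
  show int: "integrable lebesgue (\<lambda>x. f (reindex e x)) \<longleftrightarrow> integrable lebesgue f"
    using meas integrable_distr_eq[OF R(1), of f] R(2) by (metis borel_measurable_integrable)
  show "integral\<^sup>L lebesgue (\<lambda>x. f (reindex e x)) = integral\<^sup>L lebesgue f"
  proof (cases ?f)
    case True
    then show ?thesis using integral_distr[OF R(1), of f] R(2) by metis
  next
    case False
    then show ?thesis using int
      by (metis borel_measurable_integrable not_integrable_integral_eq)
  qed
qed

lemma set_integral_reindex:
  fixes e :: "'m::finite \<Rightarrow> 'n::finite" and f :: "real^'n \<Rightarrow> real"
  assumes e: "bij e"
  shows "set_integrable lebesgue (reindex e ` S) (\<lambda>y. f (reindex (inv e) y)) \<longleftrightarrow> set_integrable lebesgue S f"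
    and "set_lebesgue_integral lebesgue (reindex e ` S) (\<lambda>y. f (reindex (inv e) y))
      = set_lebesgue_integral lebesgue S f"
proof -
  have "indicator (reindex e ` S) (reindex e x) = (indicator S x :: real)" for x :: "real^'n"
    using bij_reindex[OF e] by (simp add: indicator_def bij_is_inj inj_image_mem_iff)
  then have "(\<lambda>x. indicator S x *\<^sub>R f x)
      = (\<lambda>x. (\<lambda>y. indicator (reindex e ` S) y *\<^sub>R f (reindex (inv e) y)) (reindex e x))"
    by (simp add: reindex_reindex_inv[OF e])
  note eq = this
  show "set_integrable lebesgue (reindex e ` S) (\<lambda>y. f (reindex (inv e) y)) \<longleftrightarrow> set_integrable lebesgue S f"
    unfolding set_integrable_def eq by (rule integral_lebesgue_reindex(1)[OF e, symmetric])
  show "set_lebesgue_integral lebesgue (reindex e ` S) (\<lambda>y. f (reindex (inv e) y))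
      = set_lebesgue_integral lebesgue S f"
    unfolding set_lebesgue_integral_def eq by (rule integral_lebesgue_reindex(2)[OF e, symmetric])
qed

text \<open>
  The scalar case is obtained from the vector-valued formula by embedding the reals as \<open>real^1\<close>.
\<close>

lemma change_of_variables_wellorder:
  fixes f :: "real^'m::{finite,wellorder} \<Rightarrow> real" and g :: "real^'m::_ \<Rightarrow> real^'m::_"
  assumes S: "S \<in> sets lebesgue"
    and der: "\<And>x. x \<in> S \<Longrightarrow> (g has_derivative (\<lambda>h. J x *v h)) (at x within S)"
    and inj: "inj_on g S"
    and f: "set_integrable lebesgue (g ` S) f"
  shows "set_integrable lebesgue S (\<lambda>x. f (g x) * \<bar>det (J x)\<bar>)"
    and "set_lebesgue_integral lebesgue S (\<lambda>x. f (g x) * \<bar>det (J x)\<bar>)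
      = set_lebesgue_integral lebesgue (g ` S) f"
proof -
  let ?v = "\<lambda>y. vec (f y) :: real^1"
  have lin: "bounded_linear (vec :: real \<Rightarrow> real^1)"
    by (simp add: linear_conv_bounded_linear[symmetric] linear_iff vec_eq_iff)
  have v: "?v absolutely_integrable_on g ` S"
    using absolutely_integrable_linear[OF f lin] by (simp add: o_def)
  have der': "\<And>x. x \<in> S \<Longrightarrow> (g has_derivative (*v) (J x)) (at x within S)"
    using der by simp
  have *: "(\<lambda>x. \<bar>det (matrix ((*v) (J x)))\<bar> *\<^sub>R ?v (g x)) absolutely_integrable_on S \<and>
      integral S (\<lambda>x. \<bar>det (matrix ((*v) (J x)))\<bar> *\<^sub>R ?v (g x)) = integral (g ` S) ?v"
    using has_absolute_integral_change_of_variables[OF S der' inj, of ?v] v by simp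
  have proj: "bounded_linear (\<lambda>x::real^1. x $ 1)"
    by (rule bounded_linear_vec_nth)
  show int: "set_integrable lebesgue S (\<lambda>x. f (g x) * \<bar>det (J x)\<bar>)"
    using absolutely_integrable_linear[OF conjunct1[OF *] proj] by (simp add: o_def mult.commute)
  have "integral S (\<lambda>x. f (g x) * \<bar>det (J x)\<bar>)
      = integral S (\<lambda>x. \<bar>det (matrix ((*v) (J x)))\<bar> *\<^sub>R ?v (g x)) $ 1"
    using integral_linear[OF set_lebesgue_integral_eq_integral(1)[OF conjunct1[OF *]] proj]
    by (simp add: o_def mult.commute)
  also have "\<dots> = integral (g ` S) f"
    using * integral_linear[OF set_lebesgue_integral_eq_integral(1)[OF v] proj] by (simp add: o_def)
  finally show "set_lebesgue_integral lebesgue S (\<lambda>x. f (g x) * \<bar>det (J x)\<bar>)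
      = set_lebesgue_integral lebesgue (g ` S) f"
    using int f by (simp add: set_lebesgue_integral_eq_integral(2))
qed

text \<open>
  The map \<open>g\<close> is conjugated by the renaming of coordinates. Its Jacobian matrix is then renamed in
  rows and columns, which leaves the determinant unchanged.
\<close>

theorem change_of_variables:
  fixes f :: "real^'n \<Rightarrow> real" and g :: "real^'n \<Rightarrow> real^'n"
  assumes S: "S \<in> sets lebesgue"
    and der: "\<And>x. x \<in> S \<Longrightarrow> (g has_derivative (\<lambda>h. J x *v h)) (at x within S)"
    and inj: "inj_on g S"
    and f: "set_integrable lebesgue (g ` S) f"
  shows "set_integrable lebesgue S (\<lambda>x. f (g x) * \<bar>det (J x)\<bar>)"
    and "set_lebesgue_integral lebesgue S (\<lambda>x. f (g x) * \<bar>det (J x)\<bar>)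
      = set_lebesgue_integral lebesgue (g ` S) f"
proof -
  let ?e = "Rep_ordered_copy :: 'n ordered_copy \<Rightarrow> 'n"
  let ?R = "reindex ?e" and ?Q = "reindex (inv ?e)"
  let ?g = "\<lambda>y. ?R (g (?Q y))"
  let ?J = "\<lambda>y. \<chi> i j. J (?Q y) $ ?e i $ ?e j"
  let ?f = "\<lambda>y. f (?Q y)"
  note e = bij_Rep_ordered_copy
  note [simp] = reindex_reindex_inv[OF e]
  have bl: "bounded_linear ?R" "bounded_linear ?Q"
    using linear_reindex linear_conv_bounded_linear by blast+
  have img: "?g ` (?R ` S) = ?R ` (g ` S)" by (simp add: image_image)
  have S': "?R ` S \<in> sets lebesgue"
  proof -
    have "?R ` S = ?Q -` S \<inter> space lebesgue"
      by (auto simp: image_iff) (metis reindex_reindex_inv[OF e])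
    then show ?thesis
      using measurable_sets[OF lebesgue_reindex(1)[OF bij_imp_bij_inv[OF e]] S] by simp
  qed
  have der': "(?g has_derivative (\<lambda>h. ?J y *v h)) (at y within ?R ` S)" if "y \<in> ?R ` S" for y
  proof -
    have 1: "(?Q has_derivative ?Q) (at y within ?R ` S)"
      by (rule bounded_linear_imp_has_derivative[OF bl(2)])
    have "?Q ` ?R ` S = S" by (simp add: image_image)
    moreover have "?Q y \<in> S" using that by auto
    ultimately have 2: "(g has_derivative (\<lambda>h. J (?Q y) *v h)) (at (?Q y) within ?Q ` ?R ` S)"
      using der by simp
    have 3: "(?R has_derivative ?R) (at (g (?Q y)) within g ` ?Q ` ?R ` S)"
      by (rule bounded_linear_imp_has_derivative[OF bl(1)])
    have "(?g has_derivative (\<lambda>h. ?R (J (?Q y) *v ?Q h))) (at y within ?R ` S)"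
      using has_derivative_in_compose[OF has_derivative_in_compose[OF 1 2] , of ?R ?R] 3
      by (simp add: image_image)
    moreover have "?R (J (?Q y) *v ?Q h) = ?J y *v h" for h
      using sum.reindex_bij_betw[OF e, of "\<lambda>j. J (?Q y) $ ?e i $ j * h $ inv ?e j" for i]
      by (simp add: reindex_def matrix_vector_mult_def vec_eq_iff inv_f_f[OF bij_is_inj[OF e]])
    ultimately show ?thesis by simp
  qed
  have inj': "inj_on ?g (?R ` S)"
  proof (rule inj_onI)
    fix x y assume "x \<in> ?R ` S" "y \<in> ?R ` S" "?g x = ?g y"
    then show "x = y"
      using inj by (metis (no_types, lifting) imageE inj_onD reindex_reindex_inv[OF e])
  qed
  have f': "set_integrable lebesgue (?g ` (?R ` S)) ?f"
    unfolding img using f set_integral_reindex(1)[OF e, of "g ` S" f] by simp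
  note cov = change_of_variables_wellorder[OF S' der' inj' f']
  have eq: "(\<lambda>y. ?f (?g y) * \<bar>det (?J y)\<bar>) = (\<lambda>y. (\<lambda>x. f (g x) * \<bar>det (J x)\<bar>) (?Q y))"
    by (simp add: det_reindex[OF e])
  show "set_integrable lebesgue S (\<lambda>x. f (g x) * \<bar>det (J x)\<bar>)"
    using cov(1) set_integral_reindex(1)[OF e, of S "\<lambda>x. f (g x) * \<bar>det (J x)\<bar>"]
    unfolding eq by blast
  show "set_lebesgue_integral lebesgue S (\<lambda>x. f (g x) * \<bar>det (J x)\<bar>)
      = set_lebesgue_integral lebesgue (g ` S) f"
    using cov(2) set_integral_reindex(2)[OF e, of S "\<lambda>x. f (g x) * \<bar>det (J x)\<bar>"]
      set_integral_reindex(2)[OF e, of "g ` S" f]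
    unfolding eq img by simp
qed

section \<open>Lebesgue measure in an orthonormal frame\<close>

text \<open>
  The slices of a Lebesgue measurable function are only almost everywhere equal to Borel functions,
  for almost every parameter. This and the next lemma transfer statements from the Borel
  representative to the completion.
\<close>

lemma borel_measurable_completion_AE:
  fixes f g :: "'a \<Rightarrow> real"
  assumes g: "g \<in> borel_measurable M" and ae: "AE x in M. f x = g x"
  shows "f \<in> borel_measurable (completion M)"
proof (rule measurableI)
  fix X :: "real set" assume X: "X \<in> sets borel"
  show "f -` X \<inter> space (completion M) \<in> sets (completion M)"
  proof (rule completion.in_sets_AE)
    show "AE x in completion M. (x \<in> g -` X \<inter> space M) = (x \<in> f -` X \<inter> space (completion M))"
      using AE_completion[OF ae] by eventually_elim auto
    show "g -` X \<inter> space M \<in> sets (completion M)"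
      using measurable_sets[OF g X] by simp
  qed simp
qed simp

lemma integral_completion_AE:
  fixes f g :: "'a \<Rightarrow> real"
  assumes g: "g \<in> borel_measurable M" and ae: "AE x in M. f x = g x"
  shows "integrable (completion M) f \<longleftrightarrow> integrable M g"
    and "integral\<^sup>L (completion M) f = integral\<^sup>L M g"
proof -
  note f = borel_measurable_completion_AE[OF g ae]
  show "integrable (completion M) f \<longleftrightarrow> integrable M g"
    using integrable_cong_AE[OF f measurable_completion[OF g] AE_completion[OF ae]]
      integrable_completion[OF g] by blast
  show "integral\<^sup>L (completion M) f = integral\<^sup>L M g"
    using integral_cong_AE[OF f measurable_completion[OF g] AE_completion[OF ae]]
      integral_completion[OF g] by simp
qed

text \<open>
  The determinant of an orthogonal map is \<open>1\<close> or \<open>-1\<close>, so the change of variables formula for the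
  indicator of a box shows that the preimage of a box has the volume of the box.
\<close>

lemma distr_lborel_orthogonal_transformation:
  fixes T :: "real^'n \<Rightarrow> real^'n"
  assumes T: "orthogonal_transformation T"
  shows "distr lborel borel T = lborel"
proof (rule lborel_eqI[symmetric])
  fix l u :: "real^'n"
  assume lu: "\<And>b. b \<in> Basis \<Longrightarrow> l \<bullet> b \<le> u \<bullet> b"
  have lin: "linear T" using T by (rule orthogonal_transformation_linear)
  then have [measurable]: "T \<in> borel_measurable borel"
    using linear_conv_bounded_linear borel_measurable_continuous_onI linear_continuous_on by blast
  let ?f = "\<lambda>x. indicator (box l u) x :: real"
  have der: "(T has_derivative (\<lambda>h. matrix T *v h)) (at x within UNIV)" for x
    using bounded_linear_imp_has_derivative[of T "at x within UNIV"] lin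
    by (simp add: linear_conv_bounded_linear matrix_works)
  have "\<bar>det (matrix T)\<bar> = 1"
    using det_orthogonal_matrix[of "matrix T"] T
    by (auto simp: orthogonal_transformation_matrix)
  moreover have surj: "T ` UNIV = UNIV" and inj: "inj T"
    using T orthogonal_transformation_surj orthogonal_transformation_inj by blast+
  moreover have fin: "emeasure lborel (box l u) < top"
    using emeasure_bounded_finite[OF bounded_box, of l u] by simp
  moreover have f: "integrable lebesgue ?f"
    by (subst integrable_completion) (simp_all add: integrable_indicator_iff fin)
  ultimately have "integrable lebesgue (\<lambda>x. ?f (T x))" "(\<integral>x. ?f (T x) \<partial>lebesgue) = (\<integral>x. ?f x \<partial>lebesgue)"
    using change_of_variables[of UNIV T "\<lambda>_. matrix T" ?f] der
    by (simp_all add: set_integrable_def set_lebesgue_integral_def)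
  moreover have "(\<lambda>x. ?f (T x)) = (\<lambda>x. indicator (T -` box l u) x)"
    by (simp add: indicator_def fun_eq_iff)
  moreover have "T -` box l u \<in> sets borel"
    using measurable_sets[of T borel borel "box l u"] by simp
  ultimately have "integrable lborel (indicator (T -` box l u) :: _ \<Rightarrow> real)"
      "measure lborel (T -` box l u) = measure lborel (box l u)"
    by (simp_all add: integrable_completion)
  then have "emeasure lborel (T -` box l u) = emeasure lborel (box l u)"
    using fin by (simp add: integrable_indicator_iff emeasure_eq_ennreal_measure less_top[symmetric]
        del: emeasure_lborel_box_eq)
  then show "emeasure (distr lborel borel T) (box l u) = (\<Prod>b\<in>Basis. (u - l) \<bullet> b)"
    using lu by (simp add: emeasure_distr emeasure_lborel_box)
qed simp

lemma orthonormal_complement_basisD: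
  fixes u :: "real^'n"
  assumes "norm u = 1" and U: "orthonormal_complement_basis u U"
  shows "finite U" "u \<notin> U" "card (insert u U) = CARD('n)"
    and "\<And>v w. v \<in> insert u U \<Longrightarrow> w \<in> insert u U \<Longrightarrow> v \<bullet> w = (if v = w then 1 else 0)"
proof -
  have orth: "pairwise orthogonal U" and unit: "\<And>v. v \<in> U \<Longrightarrow> norm v = 1"
    and sp: "span U = {x. x \<bullet> u = 0}"
    using U by (auto simp: orthonormal_complement_basis_def)
  have perp: "v \<bullet> u = 0" "u \<bullet> v = 0" if "v \<in> U" for v
    using sp span_base[OF that] by (auto simp: inner_commute)
  show inner: "v \<bullet> w = (if v = w then 1 else 0)" if "v \<in> insert u U" "w \<in> insert u U" for v w
    using that perp assms(1) unit orth
    by (auto simp: pairwise_def orthogonal_def norm_eq_1)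
  show "u \<notin> U"
    using perp(1)[of u] assms(1) by auto
  have po: "pairwise orthogonal (insert u U)"
    using inner by (auto simp: pairwise_def orthogonal_def)
  have "0 \<notin> insert u U" using unit[of 0] assms(1) by auto
  then have ind: "independent (insert u U)"
    by (rule pairwise_orthogonal_independent[OF po])
  then show "finite U" using independent_bound_general[of "insert u U"] by simp
  have "x \<in> span (insert u U)" for x
  proof -
    have "(x - (x \<bullet> u) *\<^sub>R u) \<bullet> u = 0"
      using assms(1) by (simp add: inner_diff_left norm_eq_1)
    then have "x - (x \<bullet> u) *\<^sub>R u \<in> span U" using sp by auto
    then show ?thesis using span_breakdown_eq by blast
  qed
  then have "span (insert u U) = UNIV" by auto
  then show "card (insert u U) = CARD('n)"
    using dim_eq_card[of "insert u U" UNIV] ind by (simp add: dim_UNIV)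
qed

definition frame_point :: "real^'n \<Rightarrow> (real^'n) set \<Rightarrow> real \<times> (real^'n \<Rightarrow> real) \<Rightarrow> real^'n" where
  "frame_point u U = (\<lambda>(t, s). t *\<^sub>R u + (\<Sum>v\<in>U. s v *\<^sub>R v))"

lemma measurable_frame_point [measurable]:
  "frame_point u U \<in> lborel \<Otimes>\<^sub>M (\<Pi>\<^sub>M v\<in>U. lborel) \<rightarrow>\<^sub>M borel"
  unfolding frame_point_def by measurable

text \<open>
  The coordinates \<open>(t, s)\<close> in the frame \<open>insert u U\<close> have the law of Lebesgue measure. With the frame
  replaced by the standard basis (through any bijection \<open>\<rho>\<close>) the preimage of a box is a product of
  intervals, which identifies the distribution; the orthogonal map \<open>T\<close> carrying the standard basis
  to the frame then preserves it.
\<close>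

lemma distr_frame_point:
  fixes u :: "real^'n"
  assumes u: "norm u = 1" and U: "orthonormal_complement_basis u U"
  shows "distr (lborel \<Otimes>\<^sub>M (\<Pi>\<^sub>M v\<in>U. lborel)) borel (frame_point u U) = lborel"
proof -
  note F = orthonormal_complement_basisD[OF u U]
  let ?P = "\<Pi>\<^sub>M v\<in>U. (lborel :: real measure)"
  interpret P: product_sigma_finite "\<lambda>_::real^'n. lborel :: real measure" ..
  interpret P: sigma_finite_measure ?P by (rule P.sigma_finite[OF F(1)])
  obtain \<rho> where \<rho>: "bij_betw \<rho> (insert u U) (Basis :: (real^'n) set)"
    using finite_same_card_bij[of "insert u U" "Basis :: (real^'n) set"] F(1,3) by auto
  define \<pi> where "\<pi> = inv_into (insert u U) \<rho>"
  have \<pi>: "\<And>v. v \<in> insert u U \<Longrightarrow> \<pi> (\<rho> v) = v" "\<And>b. b \<in> Basis \<Longrightarrow> \<pi> b \<in> insert u U"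
    "\<And>b. b \<in> Basis \<Longrightarrow> \<rho> (\<pi> b) = b"
    unfolding \<pi>_def using bij_betw_inv_into_left[OF \<rho>] bij_betw_inv_into_right[OF \<rho>]
      bij_betwE[OF bij_betw_inv_into[OF \<rho>]] by blast+
  have \<rho>B: "\<rho> v \<in> Basis" if "v \<in> insert u U" for v
    using \<rho> that by (auto simp: bij_betw_def)
  define T where "T = (\<lambda>x::real^'n. \<Sum>b\<in>Basis. (x \<bullet> b) *\<^sub>R \<pi> b)"
  have Tx: "T x = (\<Sum>b\<in>Basis. (x \<bullet> b) *\<^sub>R \<pi> b)" for x
    by (simp add: T_def)
  have linT: "linear T"
  proof (rule linearI)
    show "T (x + y) = T x + T y" for x y
      by (simp add: T_def inner_add_left scaleR_add_left sum.distrib)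
    show "T (c *\<^sub>R x) = c *\<^sub>R T x" for c x
      by (simp add: T_def scaleR_sum_right)
  qed
  have inner\<pi>: "\<pi> b \<bullet> \<pi> b' = (if b = b' then 1 else 0)" if "b \<in> Basis" "b' \<in> Basis" for b b'
  proof -
    have "\<pi> b = \<pi> b' \<longleftrightarrow> b = b'"
      using arg_cong[of "\<pi> b" "\<pi> b'" \<rho>] unfolding \<pi>(3)[OF that(1)] \<pi>(3)[OF that(2)] by blast
    then show ?thesis
      using F(4)[OF \<pi>(2)[OF that(1)] \<pi>(2)[OF that(2)]] by simp
  qed
  have "T x \<bullet> T y = x \<bullet> y" for x y
  proof -
    have "\<pi> b \<bullet> T y = y \<bullet> b" if "b \<in> Basis" for b
    proof -
      have "\<pi> b \<bullet> T y = (\<Sum>b'\<in>Basis. (y \<bullet> b') * (if b = b' then 1 else 0))"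
        unfolding Tx inner_sum_right inner_scaleR_right
        by (rule sum.cong) (simp_all add: inner\<pi> that)
      also have "\<dots> = (\<Sum>b'\<in>Basis. if b = b' then y \<bullet> b' else 0)"
        by (rule sum.cong) auto
      finally show ?thesis using that by (simp add: sum.delta)
    qed
    moreover have "T x \<bullet> T y = (\<Sum>b\<in>Basis. (x \<bullet> b) * (\<pi> b \<bullet> T y))"
      unfolding Tx inner_sum_left inner_scaleR_left ..
    ultimately have "T x \<bullet> T y = (\<Sum>b\<in>Basis. (x \<bullet> b) * (y \<bullet> b))"
      by simp
    also have "\<dots> = x \<bullet> y" by (rule euclidean_inner[symmetric])
    finally show ?thesis .
  qed
  then have T: "orthogonal_transformation T"
    using linT by (simp add: orthogonal_transformation_def)
  have T\<rho>: "T (\<rho> v) = v" if "v \<in> insert u U" for v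
    using \<rho>B[OF that] \<pi>(1)[OF that]
    by (simp add: T_def inner_Basis if_distrib[of "\<lambda>c. c *\<^sub>R _"] sum.delta cong: if_cong)
  define \<psi> where "\<psi> = (\<lambda>(t::real, s::real^'n \<Rightarrow> real). t *\<^sub>R \<rho> u + (\<Sum>v\<in>U. s v *\<^sub>R \<rho> v))"
  have [measurable]: "\<psi> \<in> lborel \<Otimes>\<^sub>M ?P \<rightarrow>\<^sub>M borel"
    unfolding \<psi>_def by measurable
  have T\<psi>: "T (\<psi> z) = frame_point u U z" for z
    by (cases z) (simp add: \<psi>_def frame_point_def linear_add[OF linT] linear_sum[OF linT]
        linear_cmul[OF linT] T\<rho>)
  have Basis_eq: "Basis = \<rho> ` insert u U" using \<rho> by (simp add: bij_betw_def)
  have \<rho>inner: "\<rho> v \<bullet> \<rho> w = (if v = w then 1 else 0)" if "v \<in> insert u U" "w \<in> insert u U" for v w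
    using \<rho>B that \<rho> by (auto simp: inner_Basis bij_betw_def inj_on_def)
  have \<psi>u: "\<psi> (t, s) \<bullet> \<rho> u = t" for t s
    using F(2) by (auto simp: \<psi>_def inner_add_left inner_sum_left \<rho>inner intro!: sum.neutral)
  have \<psi>v: "\<psi> (t, s) \<bullet> \<rho> v = s v" if "v \<in> U" for t s v
  proof -
    have "u \<noteq> v" using F(2) that by auto
    then have "\<psi> (t, s) \<bullet> \<rho> v = (\<Sum>w\<in>U. s w * (if w = v then 1 else 0))"
      using that by (simp add: \<psi>_def inner_add_left inner_sum_left \<rho>inner)
    also have "\<dots> = (\<Sum>w\<in>U. if w = v then s w else 0)"
      by (rule sum.cong) auto
    finally show ?thesis using that F(1) by (simp add: sum.delta)
  qed
  have "distr (lborel \<Otimes>\<^sub>M ?P) borel \<psi> = lborel"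
  proof (rule lborel_eqI[symmetric])
    fix l h :: "real^'n"
    assume lh: "\<And>b. b \<in> Basis \<Longrightarrow> l \<bullet> b \<le> h \<bullet> b"
    let ?I = "\<lambda>v. {l \<bullet> \<rho> v <..< h \<bullet> \<rho> v}"
    have "\<psi> -` box l h \<inter> space (lborel \<Otimes>\<^sub>M ?P) = ?I u \<times> (\<Pi>\<^sub>E v\<in>U. ?I v)"
      by (auto simp: space_pair_measure space_PiM mem_box Basis_eq \<psi>u \<psi>v PiE_iff)
    then have "emeasure (distr (lborel \<Otimes>\<^sub>M ?P) borel \<psi>) (box l h)
        = emeasure lborel (?I u) * emeasure ?P (\<Pi>\<^sub>E v\<in>U. ?I v)"
      by (simp add: emeasure_distr P.emeasure_pair_measure_Times sets_PiM_I_finite[OF F(1)])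
    also have "\<dots> = (\<Prod>v\<in>insert u U. ennreal ((h - l) \<bullet> \<rho> v))"
      using F(1,2) lh \<rho>B by (simp add: P.emeasure_PiM inner_diff_left)
    also have "\<dots> = ennreal (\<Prod>v\<in>insert u U. (h - l) \<bullet> \<rho> v)"
      by (rule prod_ennreal) (use lh \<rho>B in \<open>simp add: inner_diff_left\<close>)
    also have "(\<Prod>v\<in>insert u U. (h - l) \<bullet> \<rho> v) = (\<Prod>b\<in>Basis. (h - l) \<bullet> b)"
      by (rule prod.reindex_bij_betw[OF \<rho>])
    finally show "emeasure (distr (lborel \<Otimes>\<^sub>M ?P) borel \<psi>) (box l h) = (\<Prod>b\<in>Basis. (h - l) \<bullet> b)" .
  qed simp
  moreover have [measurable]: "T \<in> borel_measurable borel"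
    using linT linear_conv_bounded_linear borel_measurable_continuous_onI linear_continuous_on by blast
  ultimately have "distr (lborel \<Otimes>\<^sub>M ?P) borel (T \<circ> \<psi>) = distr lborel borel T"
    by (subst distr_distr[symmetric, where N = borel]) auto
  then show ?thesis
    using distr_lborel_orthogonal_transformation[OF T] T\<psi> by (simp add: o_def)
qed

lemma inner_frame_point:
  fixes u :: "real^'n"
  assumes u: "norm u = 1" and U: "orthonormal_complement_basis u U"
  shows "frame_point u U (t, s) \<bullet> u = t"
proof -
  note F = orthonormal_complement_basisD[OF u U]
  have "v \<bullet> u = 0" if "v \<in> U" for v
    using F(4)[of v u] F(2) that by auto
  moreover have "u \<bullet> u = 1" using F(4)[of u u] by simp
  ultimately show ?thesis
    by (simp add: frame_point_def inner_add_left inner_sum_left)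
qed

text \<open>
  Fubini in the frame, applied to a Borel representative \<open>G'\<close> of \<open>G\<close> cut off at the half space
  \<open>{y. y \<bullet> u \<le> x}\<close>. The half space becomes the condition \<open>t \<le> x\<close> because the \<open>u\<close>-coordinate of the
  frame point is \<open>t\<close>. The set where \<open>G\<close> and \<open>G'\<close> differ has null slices for almost every \<open>t\<close> only,
  so the projections agree almost everywhere.
\<close>

lemma integral_tomographic_projection:
  fixes u :: "real^'n"
  assumes u: "norm u = 1" and U: "orthonormal_complement_basis u U"
    and G: "integrable lebesgue G"
  shows "set_integrable lebesgue {..x} (tomographic_projection u U G)"
    and "set_lebesgue_integral lebesgue {..x} (tomographic_projection u U G)
      = (\<integral>y. G y * indicator {..x} (y \<bullet> u) \<partial>lebesgue)"
proof -
  note F = orthonormal_complement_basisD[OF u U]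
  let ?P = "\<Pi>\<^sub>M v\<in>U. (lborel :: real measure)"
  let ?M = "lborel \<Otimes>\<^sub>M ?P" and ?\<phi> = "frame_point u U"
  interpret P: product_sigma_finite "\<lambda>_::real^'n. lborel :: real measure" ..
  interpret P: sigma_finite_measure ?P by (rule P.sigma_finite[OF F(1)])
  interpret Q: pair_sigma_finite "lborel :: real measure" ?P ..
  note D = distr_frame_point[OF u U]
  obtain G' where G'[measurable]: "G' \<in> borel_measurable lborel" and ae: "AE y in lborel. G y = G' y"
    using completion_ex_borel_measurable_real[OF borel_measurable_integrable[OF G]] by blast
  have [measurable]: "G' \<in> borel_measurable borel" using G' by simp
  have intG': "integrable lborel G'"
    using integral_completion_AE(1)[OF G' ae] G by simp
  define H where "H = (\<lambda>y. G' y * indicator {..x} (y \<bullet> u))"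
  have [measurable]: "H \<in> borel_measurable borel" unfolding H_def by measurable
  have intH: "integrable lborel H"
    by (rule Bochner_Integration.integrable_bound[OF intG']) (auto simp: H_def indicator_def)
  then have intM: "integrable ?M (\<lambda>z. H (?\<phi> z))"
    using D by (metis integrable_distr measurable_frame_point)
  have "AE z in ?M. G (?\<phi> z) = G' (?\<phi> z)"
    by (rule AE_distrD[OF measurable_frame_point]) (simp only: D, rule ae)
  then have slice: "AE t in lborel. AE s in ?P. G (?\<phi> (t, s)) = G' (?\<phi> (t, s))"
    by (rule Q.AE_pair)
  have proj: "AE t in lborel. indicator {..x} t * tomographic_projection u U G t
      = (\<integral>s. H (?\<phi> (t, s)) \<partial>?P)"
    using slice
  proof eventually_elim
    case (elim t)
    have "tomographic_projection u U G t = (\<integral>s. G' (?\<phi> (t, s)) \<partial>?P)"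
      using integral_completion_AE(2)[OF _ elim]
      by (simp add: tomographic_projection_def frame_point_def)
    then show ?case
      by (simp add: H_def inner_frame_point[OF u U])
  qed
  have int1: "integrable lborel (\<lambda>t. \<integral>s. H (?\<phi> (t, s)) \<partial>?P)"
    by (rule Q.integrable_fst'[OF intM])
  show "set_integrable lebesgue {..x} (tomographic_projection u U G)"
    using integral_completion_AE(1)[OF borel_measurable_integrable[OF int1] proj] int1
    by (simp add: set_integrable_def)
  have "set_lebesgue_integral lebesgue {..x} (tomographic_projection u U G)
      = (\<integral>t. \<integral>s. H (?\<phi> (t, s)) \<partial>?P \<partial>lborel)"
    using integral_completion_AE(2)[OF borel_measurable_integrable[OF int1] proj]
    by (simp add: set_lebesgue_integral_def)
  also have "\<dots> = integral\<^sup>L ?M (\<lambda>z. H (?\<phi> z))"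
    by (rule Q.integral_fst'[OF intM])
  also have "\<dots> = integral\<^sup>L lborel H"
    using integral_distr[of ?\<phi> ?M borel H] D by simp
  also have "\<dots> = (\<integral>y. G y * indicator {..x} (y \<bullet> u) \<partial>lebesgue)"
    by (rule integral_completion_AE(2)[symmetric]) (use ae in \<open>auto simp: H_def\<close>)
  finally show "set_lebesgue_integral lebesgue {..x} (tomographic_projection u U G)
      = (\<integral>y. G y * indicator {..x} (y \<bullet> u) \<partial>lebesgue)" .
qed

section \<open>Sets of points straddled by a level\<close>

text \<open>
  The crossing set for two arbitrary height functions on a measure space. Through
  \<open>closed_segment\<close> the order of the two heights does not matter, and the closedness of the segment
  is what makes the measure upper semicontinuous in \<open>t\<close>.
\<close>

definition straddle :: "'a measure \<Rightarrow> ('a \<Rightarrow> real) \<Rightarrow> ('a \<Rightarrow> real) \<Rightarrow> real \<Rightarrow> 'a set" where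
  "straddle M \<alpha> \<beta> t = {y \<in> space M. t \<in> closed_segment (\<alpha> y) (\<beta> y)}"

lemma in_segment_real_iff:
  "t \<in> closed_segment a b \<longleftrightarrow> (a \<le> t \<and> t \<le> b) \<or> (b \<le> t \<and> t \<le> (a::real))"
  by (auto simp: closed_segment_eq_real_ivl)

lemma sets_straddle:
  assumes [measurable]: "\<alpha> \<in> borel_measurable M" "\<beta> \<in> borel_measurable M"
  shows "straddle M \<alpha> \<beta> t \<in> sets M"
  unfolding straddle_def in_segment_real_iff by measurable

text \<open>
  When levels converge to \<open>l\<close>, every point straddled by infinitely many of them is straddled by
  \<open>l\<close>, because segments are closed. In a finite measure space the measure of the limit superior of
  sets is at least the limit superior of their measures. So a limit point of a maximising sequence
  of levels is a maximiser.
\<close>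

lemma (in finite_measure) straddle_measure_attains_max:
  assumes \<alpha>: "\<alpha> \<in> borel_measurable M" and \<beta>: "\<beta> \<in> borel_measurable M"
    and K: "compact K" "K \<noteq> {}"
  shows "\<exists>t\<in>K. \<forall>s\<in>K. measure M (straddle M \<alpha> \<beta> s) \<le> measure M (straddle M \<alpha> \<beta> t)"
proof -
  let ?E = "straddle M \<alpha> \<beta>"
  let ?m = "\<lambda>t. measure M (?E t)"
  note [measurable] = sets_straddle[OF \<alpha> \<beta>]
  have bdd: "bdd_above (?m ` K)"
    by (rule bdd_aboveI[of _ "measure M (space M)"]) (auto intro: bounded_measure)
  define S where "S = (SUP s\<in>K. ?m s)"
  have "\<exists>s\<in>K. S - 1 / (real n + 1) < ?m s" for n
    using less_cSUP_iff[OF K(2) bdd, of "S - 1 / (real n + 1)"] by (simp add: S_def)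
  then obtain x where x: "\<And>n. x n \<in> K" "\<And>n. S - 1 / (real n + 1) < ?m (x n)"
    by metis
  obtain l r where l: "l \<in> K" and r: "strict_mono (r :: nat \<Rightarrow> nat)" and lim: "(x \<circ> r) \<longlonglongrightarrow> l"
    using K(1) x(1) unfolding compact_def by metis
  define W where "W n = (\<Union>k\<in>{n..}. ?E (x (r k)))" for n
  have Wm: "W n \<in> sets M" for n unfolding W_def by measurable
  have dec: "decseq W"
    unfolding W_def decseq_def by force
  \<comment> \<open>The intersection of the tails \<open>W n\<close> is the limit superior of the sets along the subsequence.\<close>
  have "(\<Inter>n. W n) \<subseteq> ?E l"
  proof
    fix y assume y: "y \<in> (\<Inter>n. W n)"
    then have sp: "y \<in> space M" by (auto simp: W_def straddle_def)
    have "l \<in> closed_segment (\<alpha> y) (\<beta> y)"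
    proof (rule ccontr)
      assume "l \<notin> closed_segment (\<alpha> y) (\<beta> y)"
      then have "\<forall>\<^sub>F n in sequentially. (x \<circ> r) n \<in> - closed_segment (\<alpha> y) (\<beta> y)"
        by (intro topological_tendstoD[OF lim]) auto
      then obtain n where "\<And>k. k \<ge> n \<Longrightarrow> x (r k) \<notin> closed_segment (\<alpha> y) (\<beta> y)"
        by (auto simp: eventually_sequentially)
      then have "y \<notin> W n" by (auto simp: W_def straddle_def)
      with y show False by blast
    qed
    then show "y \<in> ?E l" using sp by (simp add: straddle_def)
  qed
  then have "measure M (\<Inter>n. W n) \<le> ?m l"
    by (intro finite_measure_mono) measurable
  moreover have "S \<le> measure M (\<Inter>n. W n)"
  proof (rule LIMSEQ_le)
    show "(\<lambda>n. measure M (W n)) \<longlonglongrightarrow> measure M (\<Inter>n. W n)"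
      by (rule finite_Lim_measure_decseq[OF _ dec]) (use Wm in auto)
    show "(\<lambda>n. S - 1 / (real n + 1)) \<longlonglongrightarrow> S"
      using LIMSEQ_inverse_real_of_nat_add_minus[of S]
      by (simp add: inverse_eq_divide add.commute)
    have "S - 1 / (real n + 1) \<le> measure M (W n)" for n
    proof -
      have "n \<le> r n" by (rule seq_suble[OF r])
      then have "S - 1 / (real n + 1) \<le> S - 1 / (real (r n) + 1)"
        by (simp add: frac_le)
      also have "\<dots> \<le> ?m (x (r n))" using x(2)[of "r n"] by simp
      also have "\<dots> \<le> measure M (W n)"
        by (rule finite_measure_mono[OF _ Wm]) (auto simp: W_def)
      finally show ?thesis .
    qed
    then show "\<exists>N. \<forall>n\<ge>N. S - 1 / (real n + 1) \<le> measure M (W n)" by blast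
  qed
  moreover have "?m s \<le> S" if "s \<in> K" for s
    unfolding S_def by (rule cSUP_upper[OF that bdd])
  ultimately show ?thesis using l by (intro bexI[of _ l]) force+
qed

lemma borel_measurable_straddle_pair:
  fixes g :: "'a \<Rightarrow> ennreal"
  assumes [measurable]: "\<alpha> \<in> borel_measurable M" "\<beta> \<in> borel_measurable M" "g \<in> borel_measurable M"
  shows "(\<lambda>(t, y). g y * indicator (straddle M \<alpha> \<beta> t) y) \<in> borel_measurable (lborel \<Otimes>\<^sub>M M)"
proof -
  let ?E = "{z \<in> space (lborel \<Otimes>\<^sub>M M). snd z \<in> straddle M \<alpha> \<beta> (fst z)}"
  have [measurable]: "?E \<in> sets (lborel \<Otimes>\<^sub>M M)"
    unfolding straddle_def in_segment_real_iff by measurable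
  have "(\<lambda>z. g (snd z) * indicator ?E z) \<in> borel_measurable (lborel \<Otimes>\<^sub>M M)"
    by measurable
  then show ?thesis
    by (rule measurable_cong[THEN iffD1, rotated]) (auto simp: indicator_def)
qed

text \<open>
  For fixed \<open>y\<close>, the levels \<open>t\<close> at which \<open>y\<close> straddles form the segment between \<open>\<alpha> y\<close> and \<open>\<beta> y\<close>,
  whose length is at most \<open>\<epsilon>\<close>. Exchanging the order of integration gives the claim.
\<close>

lemma nn_integral_straddle_le:
  assumes "sigma_finite_measure M"
    and \<alpha>[measurable]: "\<alpha> \<in> borel_measurable M" and \<beta>[measurable]: "\<beta> \<in> borel_measurable M"
    and g[measurable]: "g \<in> borel_measurable M"
    and \<epsilon>: "\<And>y. y \<in> space M \<Longrightarrow> \<bar>\<alpha> y - \<beta> y\<bar> \<le> \<epsilon>"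
  shows "(\<integral>\<^sup>+t. (\<integral>\<^sup>+y. g y * indicator (straddle M \<alpha> \<beta> t) y \<partial>M) \<partial>lborel) \<le> ennreal \<epsilon> * (\<integral>\<^sup>+y. g y \<partial>M)"
proof -
  interpret M: sigma_finite_measure M by fact
  interpret P: pair_sigma_finite "lborel :: real measure" M ..
  note [measurable] = borel_measurable_straddle_pair[OF \<alpha> \<beta> g]
  have "(\<integral>\<^sup>+t. (\<integral>\<^sup>+y. g y * indicator (straddle M \<alpha> \<beta> t) y \<partial>M) \<partial>lborel)
      = (\<integral>\<^sup>+y. (\<integral>\<^sup>+t. g y * indicator (straddle M \<alpha> \<beta> t) y \<partial>lborel) \<partial>M)"
    by (rule P.Fubini'[symmetric]) measurable
  also have "\<dots> \<le> (\<integral>\<^sup>+y. ennreal \<epsilon> * g y \<partial>M)"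
  proof (rule nn_integral_mono)
    fix y assume y: "y \<in> space M"
    have "(\<integral>\<^sup>+t. g y * indicator (straddle M \<alpha> \<beta> t) y \<partial>lborel)
        = (\<integral>\<^sup>+t. g y * indicator (closed_segment (\<alpha> y) (\<beta> y)) t \<partial>lborel)"
      by (rule nn_integral_cong) (use y in \<open>auto simp: straddle_def indicator_def\<close>)
    also have "\<dots> = g y * emeasure lborel (closed_segment (\<alpha> y) (\<beta> y))"
      by (rule nn_integral_cmult_indicator) (simp add: closed_segment_eq_real_ivl)
    also have "\<dots> = g y * ennreal \<bar>\<alpha> y - \<beta> y\<bar>"
      by (auto simp: closed_segment_eq_real_ivl)
    also have "\<dots> \<le> g y * ennreal \<epsilon>"
      using \<epsilon>[OF y] by (intro mult_left_mono ennreal_leI) auto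
    finally show "(\<integral>\<^sup>+t. g y * indicator (straddle M \<alpha> \<beta> t) y \<partial>lborel) \<le> ennreal \<epsilon> * g y"
      by (simp add: mult.commute)
  qed
  also have "\<dots> = ennreal \<epsilon> * (\<integral>\<^sup>+y. g y \<partial>M)"
    by (rule nn_integral_cmult) measurable
  finally show ?thesis .
qed

text \<open>
  Hoelder's inequality for \<open>\<bar>f\<bar>\<close> against the indicator of \<open>E\<close>. With \<open>a\<close> the mean of \<open>\<bar>f\<bar>\<close> over \<open>E\<close>,
  convexity puts \<open>s powr q\<close> above its tangent at \<open>a\<close>; integrating this over \<open>E\<close> gives the inequality
  between the power of the mean and the mean of the power.
\<close>

lemma Hoelder_indicator:
  fixes f :: "'a \<Rightarrow> real"
  assumes q: "1 < q" and E: "E \<in> sets M" "emeasure M E < \<infinity>"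
    and f: "integrable M f" and fq: "integrable M (\<lambda>y. \<bar>f y\<bar> powr q)"
  shows "(\<integral>y. \<bar>f y\<bar> * indicator E y \<partial>M) powr q
    \<le> measure M E powr (q - 1) * (\<integral>y. \<bar>f y\<bar> powr q * indicator E y \<partial>M)"
proof -
  let ?I = "\<integral>y. \<bar>f y\<bar> * indicator E y \<partial>M" and ?J = "\<integral>y. \<bar>f y\<bar> powr q * indicator E y \<partial>M"
  let ?m = "measure M E"
  have intI: "integrable M (\<lambda>y. \<bar>f y\<bar> * indicator E y)"
    using E f by (intro integrable_real_mult_indicator integrable_abs)
  have intJ: "integrable M (\<lambda>y. \<bar>f y\<bar> powr q * indicator E y)"
    using E fq by (intro integrable_real_mult_indicator)
  have I0: "0 \<le> ?I" and J0: "0 \<le> ?J" by simp_all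
  show ?thesis
  proof (cases "?I = 0")
    case True
    then show ?thesis using J0 by simp
  next
    case False
    with I0 have Ipos: "0 < ?I" by (metis order_le_less)
    have mpos: "0 < ?m"
    proof (rule ccontr)
      assume "\<not> 0 < ?m"
      then have "measure M E = 0" using measure_nonneg[of M E] by linarith
      then have "emeasure M E = 0"
        using emeasure_eq_ennreal_measure[of M E] E(2) by simp
      then have "AE y in M. y \<notin> E" using E by (simp add: AE_not_in null_setsI)
      then have "AE y in M. \<bar>f y\<bar> * indicator E y = 0" by eventually_elim simp
      then have "?I = 0" by (rule integral_eq_zero_AE)
      with False show False by simp
    qed
    define a where "a = ?I / ?m"
    have a: "0 < a" "?I = a * ?m" using Ipos mpos by (simp_all add: a_def)
    have tangent: "q * a powr (q - 1) * s \<le> s powr q + (q - 1) * a powr q" if "0 \<le> s" for s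
    proof -
      \<comment> \<open>The tangent inequality is Young's inequality for \<open>s\<close> and \<open>a powr (q - 1)\<close>.\<close>
      have "s * a powr (q - 1) \<le> s powr q / q + (a powr (q - 1)) powr (q / (q - 1)) / (q / (q - 1))"
        by (rule Youngs_inequality) (use q that in \<open>auto simp: field_simps\<close>)
      also have "(a powr (q - 1)) powr (q / (q - 1)) = a powr q"
        using q by (simp add: powr_powr)
      finally have "q * (s * a powr (q - 1)) \<le> q * (s powr q / q + a powr q / (q / (q - 1)))"
        using q by (intro mult_left_mono) auto
      also have "q * (s powr q / q + a powr q / (q / (q - 1))) = s powr q + (q - 1) * a powr q"
        using q by (simp add: distrib_left)
      finally show ?thesis by (simp add: mult_ac)
    qed
    have intE: "integrable M (indicator E :: _ \<Rightarrow> real)"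
      using E by simp
    have "(\<integral>y. q * a powr (q - 1) * (\<bar>f y\<bar> * indicator E y) \<partial>M)
        \<le> (\<integral>y. \<bar>f y\<bar> powr q * indicator E y + (q - 1) * a powr q * indicator E y \<partial>M)"
    proof (rule integral_mono)
      show "integrable M (\<lambda>y. q * a powr (q - 1) * (\<bar>f y\<bar> * indicator E y))"
        by (intro integrable_mult_right intI)
      show "integrable M (\<lambda>y. \<bar>f y\<bar> powr q * indicator E y + (q - 1) * a powr q * indicator E y)"
        by (intro Bochner_Integration.integrable_add intJ integrable_mult_right intE)
    qed (simp add: indicator_def tangent)
    then have "q * a powr (q - 1) * ?I \<le> ?J + (q - 1) * a powr q * ?m"
      using intI intJ intE E by simp
    moreover have pw: "a powr q = a * a powr (q - 1)" 
      using a(1) by (simp add: powr_diff)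
    ultimately have "a powr q * ?m \<le> ?J"
      unfolding a(2) by (simp add: algebra_simps)
    then have "?m powr (q - 1) * (a powr q * ?m) \<le> ?m powr (q - 1) * ?J"
      by (rule mult_left_mono) simp
    moreover have "?I powr q = ?m powr (q - 1) * (a powr q * ?m)"
      unfolding a(2) using a(1) mpos by (simp add: powr_mult powr_diff)
    ultimately show ?thesis by simp
  qed
qed

section \<open>\<open>L\<^sup>p\<close> bounds for differences of sublevel integrals\<close>

lemma inv_exponent_finite:
  assumes "1 \<le> p" "p \<noteq> \<infinity>"
  shows "1 \<le> enn2real p" "inv_exponent p = 1 / enn2real p"
proof -
  have p: "p = ennreal (enn2real p)" using assms by (simp add: less_top)
  show q: "1 \<le> enn2real p"
    using assms(1) p by (metis ennreal_1 ennreal_le_iff2 enn2real_nonneg not_one_le_zero order_trans zero_le_one)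
  have "1 / p = ennreal (1 / enn2real p)"
    using q by (subst p) (simp add: divide_ennreal[symmetric] flip: ennreal_1)
  then show "inv_exponent p = 1 / enn2real p" by (simp add: inv_exponent_def)
qed

lemma Lp_norm_le:
  assumes p: "1 \<le> p" "p \<noteq> \<infinity>" and "0 \<le> K"
    and le: "(\<integral>\<^sup>+x. ennreal (\<bar>f x\<bar> powr enn2real p) \<partial>M) \<le> ennreal K"
  shows "Lp_norm M p f \<le> ennreal (K powr inv_exponent p)"
proof -
  let ?I = "\<integral>\<^sup>+x. ennreal (\<bar>f x\<bar> powr enn2real p) \<partial>M"
  have "?I \<noteq> \<infinity>" using le by (auto simp: top_unique)
  moreover have "enn2real ?I \<le> K"
    using enn2real_mono[OF le] assms(3) by simp
  ultimately show ?thesis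
    using p inv_exponent_finite[OF p] by (simp add: Lp_norm_def ennreal_leI powr_mono2)
qed

lemma Lp_norm_integrable:
  assumes p: "1 \<le> p" "p \<noteq> \<infinity>" and f: "f \<in> borel_measurable M" "Lp_norm M p f < \<infinity>"
  shows "integrable M (\<lambda>x. \<bar>f x\<bar> powr enn2real p)"
    and "Lp_norm M p f = ennreal ((\<integral>x. \<bar>f x\<bar> powr enn2real p \<partial>M) powr inv_exponent p)"
proof -
  let ?I = "\<integral>\<^sup>+x. ennreal (\<bar>f x\<bar> powr enn2real p) \<partial>M"
  have fin: "?I \<noteq> \<infinity>" using f(2) p by (auto simp: Lp_norm_def)
  show int: "integrable M (\<lambda>x. \<bar>f x\<bar> powr enn2real p)"
    using f(1) fin by (intro integrableI_nonneg) (auto simp: less_top)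
  have "?I = ennreal (\<integral>x. \<bar>f x\<bar> powr enn2real p \<partial>M)"
    by (rule nn_integral_eq_integral[OF int]) simp
  then show "Lp_norm M p f = ennreal ((\<integral>x. \<bar>f x\<bar> powr enn2real p \<partial>M) powr inv_exponent p)"
    using p fin by (simp add: Lp_norm_def)
qed

lemma Lp_norm_1_eq:
  assumes "integrable M f"
  shows "Lp_norm M 1 f = ennreal (\<integral>x. \<bar>f x\<bar> \<partial>M)"
proof -
  have "Lp_norm M 1 f < \<infinity>"
    using assms by (auto simp: Lp_norm_def Let_def integrable_iff_bounded)
  then show ?thesis
    using Lp_norm_integrable(2)[of 1 f M] assms by (simp add: inv_exponent_def)
qed

lemma Lp_norm_infinity_AE:
  assumes "Lp_norm M \<infinity> f < \<infinity>"
  shows "AE x in M. \<bar>f x\<bar> \<le> enn2real (Lp_norm M \<infinity> f)"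
proof -
  have "AE x in M. ennreal \<bar>f x\<bar> \<le> Lp_norm M \<infinity> f"
    unfolding Lp_norm_def using esssup_AE[of "\<lambda>x. ennreal \<bar>f x\<bar>" M] by simp
  then show ?thesis
  proof eventually_elim
    case (elim x)
    then show ?case using enn2real_mono[OF elim] assms by simp
  qed
qed

lemma (in finite_measure) Lp_imp_integrable:
  assumes p: "1 \<le> p" and f: "f \<in> borel_measurable M" "Lp_norm M p f < \<infinity>"
  shows "integrable M f"
proof (cases "p = \<infinity>")
  case True
  then have "AE x in M. norm (f x) \<le> enn2real (Lp_norm M \<infinity> f)"
    using Lp_norm_infinity_AE f(2) by auto
  then show ?thesis by (rule integrable_const_bound) (rule f(1))
next
  case False
  have q: "1 \<le> enn2real p" by (rule inv_exponent_finite(1)[OF p False])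
  show ?thesis
  proof (rule Bochner_Integration.integrable_bound[OF _ f(1)])
    show "integrable M (\<lambda>x. 1 + \<bar>f x\<bar> powr enn2real p)"
      using Lp_norm_integrable(1)[OF p False f] by simp
    have "\<bar>f x\<bar> \<le> 1 + \<bar>f x\<bar> powr enn2real p" for x
    proof (cases "\<bar>f x\<bar> \<le> 1")
      case True then show ?thesis by (simp add: add_increasing2)
    next
      case False
      then have "\<bar>f x\<bar> powr 1 \<le> \<bar>f x\<bar> powr enn2real p" using q by (intro powr_mono) auto
      then show ?thesis using False by simp
    qed
    then show "AE x in M. norm (f x) \<le> norm (1 + \<bar>f x\<bar> powr enn2real p)" by auto
  qed
qed

text \<open>
  The core estimate: \<open>D t\<close> is the difference of the integrals of \<open>f\<close> over the sublevel sets of \<open>\<alpha>\<close>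
  and \<open>\<beta>\<close>. The sublevel sets differ inside the straddling set only, so \<open>\<bar>D t\<bar>\<close> is at most the
  integral \<open>I t\<close> of \<open>\<bar>f\<bar>\<close> over it. The bound with the \<open>L\<^sup>1\<close> norm \<open>F1\<close> splits off one factor of the power
  of \<open>I t\<close>, which is integrated in \<open>t\<close>, and bounds the others by \<open>F1\<close>; the bound with \<open>C\<close>
  applies Hoelder's inequality first. For \<open>p = \<infinity>\<close> both bounds hold pointwise.
\<close>

lemma (in finite_measure) Lp_norm_level_difference_le:
  assumes p: "1 \<le> p" and \<epsilon>0: "0 < \<epsilon>"
    and f: "f \<in> borel_measurable M" "Lp_norm M p f < \<infinity>"
    and \<alpha>[measurable]: "\<alpha> \<in> borel_measurable M" and \<beta>[measurable]: "\<beta> \<in> borel_measurable M"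
    and \<epsilon>: "\<And>y. y \<in> space M \<Longrightarrow> \<bar>\<alpha> y - \<beta> y\<bar> \<le> \<epsilon>"
    and C: "\<And>t. measure M (straddle M \<alpha> \<beta> t) \<le> C"
    and S: "S \<in> sets lebesgue"
  defines "D \<equiv> \<lambda>t. \<integral>y. f y * (indicator {..t} (\<alpha> y) - indicator {..t} (\<beta> y)) \<partial>M"
  shows "Lp_norm (lebesgue_on S) p D
    \<le> ennreal (\<epsilon> powr inv_exponent p) * min (ennreal (conj_power C p) * Lp_norm M p f) (Lp_norm M 1 f)"
proof -
  let ?E = "straddle M \<alpha> \<beta>"
  define I where "I t = (\<integral>y. \<bar>f y\<bar> * indicator (?E t) y \<partial>M)" for t
  define F1 where "F1 = (\<integral>y. \<bar>f y\<bar> \<partial>M)"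
  note E[measurable] = sets_straddle[OF \<alpha> \<beta>]
  note f(1)[measurable]
  have intf: "integrable M f" by (rule Lp_imp_integrable[OF p f])
  have C0: "0 \<le> C" using C[of 0] measure_nonneg order_trans by blast
  have F1: "0 \<le> F1" "Lp_norm M 1 f = ennreal F1"
    using Lp_norm_1_eq[OF intf] by (simp_all add: F1_def)
  have intI: "integrable M (\<lambda>y. \<bar>f y\<bar> * indicator (?E t) y)" for t
    using E intf by (intro integrable_real_mult_indicator integrable_abs)
  have I0: "0 \<le> I t" for t by (simp add: I_def)
  have I_F1: "I t \<le> F1" for t
    unfolding I_def F1_def using intI intf by (intro integral_mono integrable_abs) (auto simp: indicator_def)
  have D_I: "\<bar>D t\<bar> \<le> I t" for t
  proof -
    have "\<bar>D t\<bar> \<le> (\<integral>y. \<bar>f y * (indicator {..t} (\<alpha> y) - indicator {..t} (\<beta> y))\<bar> \<partial>M)"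
      unfolding D_def by (rule integral_abs_bound)
    also have "\<dots> \<le> I t"
      unfolding I_def
    proof (rule integral_mono[OF _ intI])
      show "integrable M (\<lambda>y. \<bar>f y * (indicator {..t} (\<alpha> y) - indicator {..t} (\<beta> y))\<bar>)"
        by (rule Bochner_Integration.integrable_bound[OF intf]) (auto simp: indicator_def)
    qed (auto simp: indicator_def straddle_def in_segment_real_iff abs_mult)
    finally show ?thesis .
  qed
  have nnI: "ennreal (I t) = (\<integral>\<^sup>+y. ennreal \<bar>f y\<bar> * indicator (?E t) y \<partial>M)" for t
    unfolding I_def using nn_integral_eq_integral[OF intI, of t]
    by (simp add: ennreal_mult' ennreal_indicator)
  have sf: "sigma_finite_measure M" ..
  have meas_straddle: "(\<lambda>t. \<integral>\<^sup>+y. g y * indicator (?E t) y \<partial>M) \<in> borel_measurable lborel"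
    if "g \<in> borel_measurable M" for g :: "'a \<Rightarrow> ennreal"
    using borel_measurable_nn_integral[OF borel_measurable_straddle_pair[OF \<alpha> \<beta> that]] by simp
  have intI_le: "(\<integral>\<^sup>+t. ennreal (I t) \<partial>lborel) \<le> ennreal (\<epsilon> * F1)"
  proof -
    have "(\<integral>\<^sup>+t. ennreal (I t) \<partial>lborel) \<le> ennreal \<epsilon> * (\<integral>\<^sup>+y. ennreal \<bar>f y\<bar> \<partial>M)"
      unfolding nnI by (rule nn_integral_straddle_le[OF sf \<alpha> \<beta> _ \<epsilon>]) measurable
    also have "\<dots> = ennreal (\<epsilon> * F1)"
      using nn_integral_eq_integral[OF integrable_abs[OF intf]] \<epsilon>0 F1
      by (simp add: F1_def ennreal_mult)
    finally show ?thesis .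
  qed
  have S_le: "(\<integral>\<^sup>+t. h t \<partial>lebesgue_on S) \<le> (\<integral>\<^sup>+t. k t \<partial>lborel)" if "\<And>t. h t \<le> k t" for h k :: "real \<Rightarrow> ennreal"
  proof -
    have "(\<integral>\<^sup>+t. h t \<partial>lebesgue_on S) = (\<integral>\<^sup>+t. h t * indicator S t \<partial>lebesgue)"
      using S by (simp add: nn_integral_restrict_space)
    also have "\<dots> \<le> (\<integral>\<^sup>+t. k t \<partial>lebesgue)"
      using that by (intro nn_integral_mono) (auto simp: indicator_def)
    finally show ?thesis by (simp add: nn_integral_completion)
  qed
  show ?thesis
  proof (cases "p = \<infinity>")
    case True
    define L where "L = enn2real (Lp_norm M \<infinity> f)"
    have L: "0 \<le> L" "Lp_norm M p f = ennreal L" using f(2) True by (simp_all add: L_def less_top)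
    have I_L: "I t \<le> C * L" for t
    proof -
      have "I t \<le> (\<integral>y. L * indicator (?E t) y \<partial>M)"
        unfolding I_def
      proof (rule integral_mono_AE[OF intI])
        show "integrable M (\<lambda>y. L * indicator (?E t) y)"
          using E by (simp add: emeasure_finite less_top[symmetric])
        show "AE y in M. \<bar>f y\<bar> * indicator (?E t) y \<le> L * indicator (?E t) y"
          using Lp_norm_infinity_AE[of M f] f(2) True by (auto simp: L_def indicator_def)
      qed
      also have "\<dots> = measure M (?E t) * L" using E by simp
      also have "\<dots> \<le> C * L" using C L by (intro mult_right_mono)
      finally show ?thesis .
    qed
    interpret P: pair_sigma_finite "lborel :: real measure" M
      by (intro pair_sigma_finite.intro lborel.sigma_finite_measure_axioms sf)
    have "D = (\<lambda>t. \<integral>y. f y * ((if \<alpha> y \<le> t then 1 else 0) - (if \<beta> y \<le> t then 1 else 0)) \<partial>M)"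
      by (simp add: D_def indicator_def of_bool_def)
    also have "\<dots> \<in> borel_measurable lborel" by measurable
    finally have "D \<in> borel_measurable lborel" .
    then have "D \<in> borel_measurable (lebesgue_on S)"
      by (intro measurable_restrict_space1 measurable_completion)
    moreover have "\<bar>D t\<bar> \<le> min (C * L) F1" for t
      using D_I[of t] I_L[of t] I_F1[of t] by linarith
    ultimately have "Lp_norm (lebesgue_on S) p D \<le> ennreal (min (C * L) F1)"
      using True by (auto simp: Lp_norm_def simp del: min.bounded_iff intro!: esssup_I AE_I2 ennreal_leI)
    also have "\<dots> = min (ennreal C * ennreal L) (ennreal F1)"
      using C0 L F1 by (auto simp: ennreal_mult[symmetric] min_def)
    finally show ?thesis
      using True \<epsilon>0 C0 unfolding L(2) F1(2)
      by (simp add: inv_exponent_def conj_power_def)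
  next
    case False
    define q where "q = enn2real p"
    have q: "1 \<le> q" "inv_exponent p = 1 / q"
      using inv_exponent_finite[OF p False] by (simp_all add: q_def)
    have D_q: "\<bar>D t\<bar> powr q \<le> I t powr q" for t
      using D_I[of t] q by (intro powr_mono2) auto
    have bound1: "Lp_norm (lebesgue_on S) p D \<le> ennreal (\<epsilon> powr inv_exponent p) * ennreal F1"
    proof -
      have "I t powr q \<le> F1 powr (q - 1) * I t" for t
      proof (cases "I t = 0")
        case False
        then have "I t powr q = I t powr (q - 1) * I t"
          using I0[of t] by (simp add: powr_diff)
        also have "\<dots> \<le> F1 powr (q - 1) * I t"
          using I0[of t] I_F1[of t] q by (intro mult_right_mono powr_mono2) auto
        finally show ?thesis .
      qed simp
      then have "ennreal (\<bar>D t\<bar> powr q) \<le> ennreal (F1 powr (q - 1)) * ennreal (I t)" for t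
        using D_q[of t] by (subst ennreal_mult'[symmetric]) (auto intro!: ennreal_leI intro: order_trans)
      then have "(\<integral>\<^sup>+t. ennreal (\<bar>D t\<bar> powr q) \<partial>lebesgue_on S)
          \<le> (\<integral>\<^sup>+t. ennreal (F1 powr (q - 1)) * ennreal (I t) \<partial>lborel)"
        by (rule S_le)
      also have "\<dots> = ennreal (F1 powr (q - 1)) * (\<integral>\<^sup>+t. ennreal (I t) \<partial>lborel)"
        unfolding nnI 
        by (rule nn_integral_cmult) (rule meas_straddle, measurable)
      also have "\<dots> \<le> ennreal (F1 powr (q - 1)) * ennreal (\<epsilon> * F1)"
        by (rule mult_left_mono[OF intI_le]) simp
      also have "\<dots> = ennreal (\<epsilon> * F1 powr q)"
        using \<epsilon>0 F1 q by (cases "F1 = 0") (simp_all add: ennreal_mult[symmetric] powr_diff)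
      finally have "Lp_norm (lebesgue_on S) p D \<le> ennreal ((\<epsilon> * F1 powr q) powr inv_exponent p)"
        using \<epsilon>0 by (intro Lp_norm_le[OF p False]) (simp_all add: q_def)
      also have "(\<epsilon> * F1 powr q) powr inv_exponent p = \<epsilon> powr inv_exponent p * F1"
        using \<epsilon>0 F1(1) q by (simp add: powr_mult powr_powr)
      finally show ?thesis using F1(1) by (simp add: ennreal_mult)
    qed
    have bound2: "Lp_norm (lebesgue_on S) p D
        \<le> ennreal (\<epsilon> powr inv_exponent p) * (ennreal (conj_power C p) * Lp_norm M p f)"
    \<comment> \<open>For \<open>p = 1\<close> the factor \<open>conj_power C p\<close> is 1 by convention, even when \<open>C = 0\<close>, so the second
      bound is the first one; the computation with powers of \<open>C\<close> needs \<open>1 < q\<close>.\<close>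
    proof (cases "p = 1")
      case True
      then show ?thesis using bound1 F1 by (simp add: conj_power_def)
    next
      case p1: False
      have q1: "1 < q"
      proof -
        have "q \<noteq> 1" using p1 False by (metis q_def ennreal_1 ennreal_enn2real infinity_ennreal_def less_top)
        then show ?thesis using q by simp
      qed
      define J where "J t = (\<integral>y. \<bar>f y\<bar> powr q * indicator (?E t) y \<partial>M)" for t
      define Fq where "Fq = (\<integral>y. \<bar>f y\<bar> powr q \<partial>M)"
      have intq: "integrable M (\<lambda>y. \<bar>f y\<bar> powr q)"
        unfolding q_def by (rule Lp_norm_integrable(1)[OF p False f])
      have Fq: "0 \<le> Fq" "Lp_norm M p f = ennreal (Fq powr inv_exponent p)"
        using Lp_norm_integrable(2)[OF p False f] by (simp_all add: Fq_def q_def)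
      have J0: "0 \<le> J t" for t by (simp add: J_def)
      have nnJ: "ennreal (J t) = (\<integral>\<^sup>+y. ennreal (\<bar>f y\<bar> powr q) * indicator (?E t) y \<partial>M)" for t
        unfolding J_def
        using nn_integral_eq_integral[OF integrable_real_mult_indicator[OF E intq], of t]
        by (simp add: ennreal_mult' ennreal_indicator)
      have "\<bar>D t\<bar> powr q \<le> C powr (q - 1) * J t" for t
      proof -
        have "I t powr q \<le> measure M (?E t) powr (q - 1) * J t"
          unfolding I_def J_def
          by (rule Hoelder_indicator[OF q1 E _ intf intq]) (simp add: emeasure_finite less_top[symmetric])
        also have "\<dots> \<le> C powr (q - 1) * J t"
          using C[of t] q1 J0[of t] by (intro mult_right_mono powr_mono2) auto
        finally show ?thesis using D_q[of t] by linarith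
      qed
      then have "ennreal (\<bar>D t\<bar> powr q) \<le> ennreal (C powr (q - 1)) * ennreal (J t)" for t
        by (subst ennreal_mult'[symmetric]) (auto intro!: ennreal_leI)
      then have "(\<integral>\<^sup>+t. ennreal (\<bar>D t\<bar> powr q) \<partial>lebesgue_on S)
          \<le> (\<integral>\<^sup>+t. ennreal (C powr (q - 1)) * ennreal (J t) \<partial>lborel)"
        by (rule S_le)
      also have "\<dots> = ennreal (C powr (q - 1)) * (\<integral>\<^sup>+t. ennreal (J t) \<partial>lborel)"
        unfolding nnJ by (rule nn_integral_cmult) (rule meas_straddle, measurable)
      also have "\<dots> \<le> ennreal (C powr (q - 1)) * (ennreal \<epsilon> * (\<integral>\<^sup>+y. ennreal (\<bar>f y\<bar> powr q) \<partial>M))"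
        unfolding nnJ by (intro mult_left_mono nn_integral_straddle_le[OF sf \<alpha> \<beta> _ \<epsilon>]) simp_all
      also have "\<dots> = ennreal (C powr (q - 1) * \<epsilon> * Fq)"
        using nn_integral_eq_integral[OF intq] \<epsilon>0 Fq(1)
        by (simp add: Fq_def ennreal_mult mult.assoc)
      finally have "Lp_norm (lebesgue_on S) p D \<le> ennreal ((C powr (q - 1) * \<epsilon> * Fq) powr inv_exponent p)"
        using \<epsilon>0 Fq(1) by (intro Lp_norm_le[OF p False]) (simp_all add: q_def)
      also have "(C powr (q - 1) * \<epsilon> * Fq) powr inv_exponent p
          = \<epsilon> powr inv_exponent p * (conj_power C p * Fq powr inv_exponent p)"
      proof -
        have "(q - 1) / q = 1 - 1 / q" using q1 by (simp add: field_simps)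
        then show ?thesis
          using \<epsilon>0 Fq(1) p1 q(2) by (simp add: powr_mult powr_powr conj_power_def)
      qed
      finally show ?thesis
        unfolding Fq(2) by (simp add: ennreal_mult conj_power_def)
    qed
    show ?thesis
      using bound1 bound2 F1(2) by (simp add: min_def)
  qed
qed

lemma Lp_norm_cong:
  assumes "\<And>x. x \<in> space M \<Longrightarrow> f x = g x"
  shows "Lp_norm M p f = Lp_norm M p g"
proof -
  have meas: "(\<lambda>x. ennreal \<bar>f x\<bar>) \<in> borel_measurable M \<longleftrightarrow> (\<lambda>x. ennreal \<bar>g x\<bar>) \<in> borel_measurable M"
    by (rule measurable_cong) (simp add: assms)
  have "esssup M (\<lambda>x. ennreal \<bar>f x\<bar>) = esssup M (\<lambda>x. ennreal \<bar>g x\<bar>)"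
  proof (cases "(\<lambda>x. ennreal \<bar>f x\<bar>) \<in> borel_measurable M")
    case True
    then show ?thesis using meas assms by (intro esssup_AE_cong AE_I2) auto
  next
    case False
    then show ?thesis using meas by (simp add: esssup_non_measurable)
  qed
  moreover have "(\<integral>\<^sup>+x. ennreal (\<bar>f x\<bar> powr enn2real p) \<partial>M) = (\<integral>\<^sup>+x. ennreal (\<bar>g x\<bar> powr enn2real p) \<partial>M)"
    by (rule nn_integral_cong) (simp add: assms)
  ultimately show ?thesis by (simp add: Lp_norm_def)
qed

lemma Lp_norm_lebesgue_on_le:
  fixes F :: "'a::euclidean_space \<Rightarrow> real"
  assumes A: "A \<in> sets lebesgue" and F: "F \<in> borel_measurable lebesgue" and F0: "\<And>x. x \<notin> A \<Longrightarrow> F x = 0"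
  shows "Lp_norm (lebesgue_on A) p F \<le> Lp_norm lebesgue p F"
proof (cases "p = \<infinity>")
  case True
  have "AE x in lebesgue_on A. ennreal \<bar>F x\<bar> \<le> esssup lebesgue (\<lambda>x. ennreal \<bar>F x\<bar>)"
    using esssup_AE[of "\<lambda>x. ennreal \<bar>F x\<bar>" lebesgue] A
    by (auto simp: AE_restrict_space_iff elim: eventually_mono)
  moreover have "(\<lambda>x. ennreal \<bar>F x\<bar>) \<in> borel_measurable (lebesgue_on A)"
    using measurable_restrict_space1[OF F] by measurable
  ultimately show ?thesis using True by (simp add: Lp_norm_def esssup_I)
next
  case False
  have "(\<integral>\<^sup>+x. ennreal (\<bar>F x\<bar> powr enn2real p) \<partial>lebesgue_on A)
      = (\<integral>\<^sup>+x. ennreal (\<bar>F x\<bar> powr enn2real p) * indicator A x \<partial>lebesgue)"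
    using A by (simp add: nn_integral_restrict_space)
  also have "\<dots> = (\<integral>\<^sup>+x. ennreal (\<bar>F x\<bar> powr enn2real p) \<partial>lebesgue)"
    by (rule nn_integral_cong) (auto simp: indicator_def F0)
  finally show ?thesis using False by (simp add: Lp_norm_def)
qed


section \<open>Deformations and the projection estimate\<close>

text \<open>
  The inverse of a deformation is continuous by invariance of domain; the crossing sets are
  measurable because of this.
\<close>

lemma deformationD:
  fixes \<Phi> :: "real^'n \<Rightarrow> real^'n"
  assumes B: "open B" and def: "deformation \<epsilon> B A \<Phi>"
  shows "inj_on \<Phi> B" "\<Phi> ` B = A"
    and "\<And>x. x \<in> B \<Longrightarrow> (\<Phi> has_derivative (\<lambda>h. jacobian \<Phi> (at x) *v h)) (at x)"
    and "continuous_on A (inv_into B \<Phi>)"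
    and "\<And>y. y \<in> A \<Longrightarrow> norm (y - inv_into B \<Phi> y) \<le> \<epsilon>"
proof -
  show inj: "inj_on \<Phi> B" and img: "\<Phi> ` B = A"
    using def by (auto simp: deformation_def bij_betw_def)
  show der: "(\<Phi> has_derivative (\<lambda>h. jacobian \<Phi> (at x) *v h)) (at x)" if "x \<in> B" for x
    using def that jacobian_works by (auto simp: deformation_def)
  have "continuous_on B \<Phi>"
    using der has_derivative_continuous continuous_at_imp_continuous_on by blast
  then have "continuous_on (\<Phi> ` B) (inv_into B \<Phi>)"
    using continuous_on_inverse_open[OF B _ _ _ , of \<Phi> "inv_into B \<Phi>"] inj by simp
  then show "continuous_on A (inv_into B \<Phi>)" by (simp add: img)
  show "norm (y - inv_into B \<Phi> y) \<le> \<epsilon>" if "y \<in> A" for y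
  proof -
    have "inv_into B \<Phi> y \<in> B" "\<Phi> (inv_into B \<Phi> y) = y"
      using that img by (auto simp: inv_into_into f_inv_into_f)
    then show ?thesis
      using def by (metis deformation_def norm_minus_commute)
  qed
qed

text \<open>
  The change of variables formula for \<open>F\<close> times the indicator of \<open>{z. \<Psi> z \<bullet> u \<le> x}\<close>, where
  \<open>\<Psi>\<close> is the inverse of \<open>\<Phi>\<close>: at \<open>z = \<Phi> y\<close> this indicator is that of the half space
  \<open>{y. y \<bullet> u \<le> x}\<close>.
\<close>

lemma integral_push_forward:
  fixes \<Phi> :: "real^'n \<Rightarrow> real^'n"
  assumes A: "open A" and B: "open B" and def: "deformation \<epsilon> B A \<Phi>"
    and F: "integrable (lebesgue_on A) F"
  shows "integrable lebesgue (push_forward B \<Phi> F)"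
    and "(\<integral>y. push_forward B \<Phi> F y * indicator {..x} (y \<bullet> u) \<partial>lebesgue)
      = (\<integral>z. F z * indicator {..x} (inv_into B \<Phi> z \<bullet> u) \<partial>lebesgue_on A)"
proof -
  note D = deformationD[OF B def]
  have sets: "A \<in> sets lebesgue" "B \<in> sets lebesgue" using A B by auto
  have der: "(\<Phi> has_derivative (\<lambda>h. jacobian \<Phi> (at y) *v h)) (at y within B)" if "y \<in> B" for y
    using D(3)[OF that] by (rule has_derivative_at_withinI)
  note cov = change_of_variables[OF sets(2) der D(1), unfolded D(2)]
  have "set_integrable lebesgue A F"
    using F sets by (simp add: integrable_restrict_space set_integrable_def)
  from cov(1)[OF _ this] have "set_integrable lebesgue B (\<lambda>y. F (\<Phi> y) * \<bar>det (jacobian \<Phi> (at y))\<bar>)"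
    by simp
  also have "?this \<longleftrightarrow> integrable lebesgue (push_forward B \<Phi> F)"
    unfolding set_integrable_def
    by (rule arg_cong[where f = "integrable lebesgue"]) (auto simp: push_forward_def fun_eq_iff)
  finally show "integrable lebesgue (push_forward B \<Phi> F)" .
  let ?f = "\<lambda>z. F z * indicator {..x} (inv_into B \<Phi> z \<bullet> u)"
  have "(\<lambda>z. inv_into B \<Phi> z \<bullet> u) \<in> borel_measurable (lebesgue_on A)"
    by (intro continuous_imp_measurable_on_sets_lebesgue continuous_intros D(4) sets)
  then have "integrable (lebesgue_on A) ?f"
    using F by (intro Bochner_Integration.integrable_bound[OF F]) (auto simp: indicator_def)
  then have "set_integrable lebesgue A ?f"
    using sets by (simp add: integrable_restrict_space set_integrable_def)
  from cov(2)[OF _ this]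
  have "set_lebesgue_integral lebesgue B (\<lambda>y. ?f (\<Phi> y) * \<bar>det (jacobian \<Phi> (at y))\<bar>)
      = set_lebesgue_integral lebesgue A ?f" by simp
  also have "\<dots> = integral\<^sup>L (lebesgue_on A) ?f"
    using sets by (simp add: integral_restrict_space set_lebesgue_integral_def)
  also have "set_lebesgue_integral lebesgue B (\<lambda>y. ?f (\<Phi> y) * \<bar>det (jacobian \<Phi> (at y))\<bar>)
      = (\<integral>y. push_forward B \<Phi> F y * indicator {..x} (y \<bullet> u) \<partial>lebesgue)"
    unfolding set_lebesgue_integral_def
    by (rule arg_cong[where f = "integral\<^sup>L lebesgue"])
       (auto simp: push_forward_def fun_eq_iff inv_into_f_f[OF D(1)])
  finally show "(\<integral>y. push_forward B \<Phi> F y * indicator {..x} (y \<bullet> u) \<partial>lebesgue)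
      = integral\<^sup>L (lebesgue_on A) ?f" .
qed

text \<open>
  The core estimate is applied to Lebesgue measure on \<open>A\<close>, which is finite, with the heights
  \<open>y \<bullet> u\<close> and \<open>\<Psi> y \<bullet> u\<close>.
\<close>

theorem theorem7p1:
  fixes A B :: "(real^'n) set" and F :: "real^'n \<Rightarrow> real"
    and \<Phi> \<Psi> :: "real^'n \<Rightarrow> real^'n" and u :: "real^'n" and U :: "(real^'n) set"
    and p :: ennreal and \<epsilon> r a b c :: real
  assumes "1 \<le> p" and "\<epsilon> > 0"
    and "A \<noteq> {}" "bounded A" "open A"
    and "B \<noteq> {}" "bounded B" "open B"
    and "r = diameter (A \<union> B)"
    and "F \<in> Lp_functions lebesgue p" and "\<forall>x. x \<notin> A \<longrightarrow> F x = 0"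
    and "deformation \<epsilon> B A \<Phi>" and "\<Psi> = inv_into B \<Phi>"
    and "norm u = 1" and "orthonormal_complement_basis u U"
    and "\<forall>x\<in>A \<union> B. \<bar>x \<bullet> u - c\<bar> \<le> r / 2"
    and "\<forall>t. t \<notin> {a..b} \<longrightarrow> tomographic_projection u U F t = 0
           \<and> tomographic_projection u U (push_forward B \<Phi> F) t = 0"
  shows "(\<exists>t. \<bar>t - c\<bar> \<le> r / 2
            \<and> measure lebesgue (crossing_set A \<Psi> u t) = crossing_const A \<Psi> u c r)
       \<and> volterra_norm a b p
            (\<lambda>t. tomographic_projection u U F t - tomographic_projection u U (push_forward B \<Phi> F) t)
         \<le> ennreal (\<epsilon> powr inv_exponent p)
            * min (ennreal (conj_power (crossing_const A \<Psi> u c r) p) * Lp_norm lebesgue p F)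
                  (Lp_norm lebesgue 1 F)"
proof
  let ?M = "lebesgue_on A"
  let ?\<alpha> = "\<lambda>y. y \<bullet> u" and ?\<beta> = "\<lambda>y. \<Psi> y \<bullet> u"
  let ?E = "straddle ?M ?\<alpha> ?\<beta>"
  let ?K = "{t. \<bar>t - c\<bar> \<le> r / 2}"
  let ?C = "crossing_const A \<Psi> u c r"
  let ?G = "push_forward B \<Phi> F"
  note D = deformationD[OF assms(8,12), folded assms(13)]
  have A: "A \<in> lmeasurable" "A \<in> sets lebesgue"
    using assms(4,5) by (auto simp: lmeasurable_open)
  interpret M: finite_measure ?M by (rule finite_measure_lebesgue_on[OF A(1)])
  have F: "F \<in> borel_measurable lebesgue" "Lp_norm lebesgue p F < \<infinity>"
    using assms(10) by (auto simp: Lp_functions_def)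
  have F0: "\<And>x. x \<notin> A \<Longrightarrow> F x = 0" using assms(11) by blast
  have \<alpha>: "?\<alpha> \<in> borel_measurable ?M" and \<beta>: "?\<beta> \<in> borel_measurable ?M"
    by (intro continuous_imp_measurable_on_sets_lebesgue continuous_intros D(4) A)+
  have crossing: "measure lebesgue (crossing_set A \<Psi> u t) = measure ?M (?E t)" for t
  proof -
    have "crossing_set A \<Psi> u t = ?E t"
      by (simp add: crossing_set_def straddle_def in_segment_real_iff)
    then show ?thesis
      using A by (simp add: measure_restrict_space straddle_def)
  qed
  have "r \<ge> 0" using assms(4,7,9) diameter_ge_0[of "A \<union> B"] by simp
  then have K: "compact ?K" "?K \<noteq> {}" "c \<in> ?K"
  proof -
    have "?K = cball c (r / 2)" by (auto simp: dist_real_def abs_minus_commute)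
    then show "compact ?K" by simp
  qed (auto intro: exI[of _ c])
  obtain t where t: "t \<in> ?K" "\<And>s. s \<in> ?K \<Longrightarrow> measure ?M (?E s) \<le> measure ?M (?E t)"
    using M.straddle_measure_attains_max[OF \<alpha> \<beta> K(1,2)] by blast
  then have C_eq: "?C = measure ?M (?E t)"
    unfolding crossing_const_def crossing by (intro cSup_eq_maximum) auto
  then show "\<exists>t. \<bar>t - c\<bar> \<le> r / 2 \<and> measure lebesgue (crossing_set A \<Psi> u t) = ?C"
    using t(1) crossing by auto
  have C: "measure ?M (?E s) \<le> ?C" for s
  proof (cases "s \<in> ?K")
    case True then show ?thesis using t(2) C_eq by simp
  next
    case False
    \<comment> \<open>Both \<open>y\<close> and \<open>\<Psi> y\<close> project into the window of radius \<open>r / 2\<close> around \<open>c\<close>, so nothing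
      crosses a level outside it.\<close>
    have "s \<notin> closed_segment (y \<bullet> u) (\<Psi> y \<bullet> u)" if "y \<in> A" for y
    proof -
      have "\<Psi> y \<in> B" using that D(2) assms(13) by (auto simp: inv_into_into)
      then have "\<bar>y \<bullet> u - c\<bar> \<le> r / 2" "\<bar>\<Psi> y \<bullet> u - c\<bar> \<le> r / 2"
        using assms(16) that by auto
      then show ?thesis using False unfolding in_segment_real_iff mem_Collect_eq by (smt (verit))
    qed
    then have "?E s = {}" by (auto simp: straddle_def)
    then show ?thesis using C_eq by simp
  qed
  have \<epsilon>: "\<bar>y \<bullet> u - \<Psi> y \<bullet> u\<bar> \<le> \<epsilon>" if "y \<in> space ?M" for y
  proof -
    have "\<bar>(y - \<Psi> y) \<bullet> u\<bar> \<le> norm (y - \<Psi> y) * norm u" by (rule Cauchy_Schwarz_ineq2)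
    also have "\<dots> \<le> \<epsilon>" using D(5)[of y] that assms(14) by simp
    finally show ?thesis by (simp add: inner_diff_left)
  qed
  have FM: "F \<in> borel_measurable ?M" by (rule measurable_restrict_space1[OF F(1)])
  have norm_le: "Lp_norm ?M q F \<le> Lp_norm lebesgue q F" for q
    by (rule Lp_norm_lebesgue_on_le[OF A(2) F(1) F0])
  have FMp: "Lp_norm ?M p F < \<infinity>" using norm_le F(2) by (rule le_less_trans)
  have intM: "integrable ?M F" by (rule M.Lp_imp_integrable[OF assms(1) FM FMp])
  have on_A: "integrable lebesgue (\<lambda>y. F y * w y) = integrable ?M (\<lambda>y. F y * w y)"
    "(\<integral>y. F y * w y \<partial>lebesgue) = (\<integral>y. F y * w y \<partial>?M)" for w
  proof -
    have eq: "(\<lambda>y. indicator A y *\<^sub>R (F y * w y)) = (\<lambda>y. F y * w y)"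
      by (auto simp: fun_eq_iff indicator_def F0)
    show "integrable lebesgue (\<lambda>y. F y * w y) = integrable ?M (\<lambda>y. F y * w y)"
      "(\<integral>y. F y * w y \<partial>lebesgue) = (\<integral>y. F y * w y \<partial>?M)"
      using A by (simp_all add: integrable_restrict_space integral_restrict_space eq
          del: real_scaleR_def)
  qed
  have intF: "integrable lebesgue F" using on_A(1)[of "\<lambda>_. 1"] intM by simp
  note G = integral_push_forward[OF assms(5,8,12) intM, folded assms(13)]
  note PF = integral_tomographic_projection[OF assms(14,15) intF]
  note PG = integral_tomographic_projection[OF assms(14,15) G(1)]
  define L where "L t = (\<integral>y. F y * (indicator {..t} (?\<alpha> y) - indicator {..t} (?\<beta> y)) \<partial>?M)" for t
  let ?h = "\<lambda>t. tomographic_projection u U F t - tomographic_projection u U ?G t"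
  have V: "volterra a ?h x = L x" if "x \<in> {a..b}" for x
  proof -
    \<comment> \<open>Below \<open>a\<close> both projections vanish, so the integral may start at minus infinity.\<close>
    have "volterra a ?h x = set_lebesgue_integral lebesgue {..x} ?h"
      unfolding volterra_def set_lebesgue_integral_def
      by (rule Bochner_Integration.integral_cong) (use assms(17) that in \<open>auto simp: indicator_def\<close>)
    also have "\<dots> = (\<integral>y. F y * indicator {..x} (?\<alpha> y) \<partial>?M) - (\<integral>y. F y * indicator {..x} (?\<beta> y) \<partial>?M)"
      by (simp add: set_integral_diff(2)[OF PF(1) PG(1)] PF(2) PG(2) G(2) on_A(2))
    also have "\<dots> = L x"
    proof -
      have "integrable ?M (\<lambda>y. F y * indicator {..x} (w y))" if "w \<in> borel_measurable ?M" for w :: "_ \<Rightarrow> real"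
      proof (rule Bochner_Integration.integrable_bound[OF intM])
        show "(\<lambda>y. F y * indicator {..x} (w y)) \<in> borel_measurable ?M"
          using that FM by measurable
      qed (simp add: indicator_def)
      from Bochner_Integration.integral_diff[OF this[OF \<alpha>] this[OF \<beta>]]
      show ?thesis by (simp add: L_def right_diff_distrib)
    qed
    finally show ?thesis .
  qed
  have "volterra_norm a b p ?h = Lp_norm (lebesgue_on {a..b}) p L"
    unfolding volterra_norm_def by (rule Lp_norm_cong) (simp add: V)
  also have "\<dots> \<le> ennreal (\<epsilon> powr inv_exponent p)
      * min (ennreal (conj_power ?C p) * Lp_norm ?M p F) (Lp_norm ?M 1 F)"
    unfolding L_def
    by (rule M.Lp_norm_level_difference_le[OF assms(1,2) FM FMp \<alpha> \<beta> \<epsilon> C]) simp_all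
  also have "\<dots> \<le> ennreal (\<epsilon> powr inv_exponent p)
      * min (ennreal (conj_power ?C p) * Lp_norm lebesgue p F) (Lp_norm lebesgue 1 F)"
    by (intro mult_left_mono min.mono norm_le) simp_all
  finally show "volterra_norm a b p ?h \<le> \<dots>" .
qed

end
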